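(* Let $P$ be a finite poset, $K$ a finite simplicial complex, $\mathsf{F}:P\to\mathsf{SubCx}(K)$ a filtration, and $\rho\ge0$ an integer. Then, for every $(b,d)\in\mathsf{Seg}(P)$, $\dim\big(H_0^\downarrow\mathsf{ZB}_\rho^{\mathsf{F}}((b,d))\big)$ equals the number of independent $\rho$-cycles that are born at $b$ and die at $d$, i.e. $$\dim\big(H_0^\downarrow\mathsf{ZB}_\rho^{\mathsf{F}}((b,d))\big)=\dim\left(\frac{\mathsf{ZB}_\rho^{\mathsf{F}}((b,d))}{W_\rho^{\mathsf{F}}((b,d))}\right).$$
   Context: Segments: $\mathsf{Seg}(P)$ consists of all pairs $(b,d)$ with $b\le d$ in $P$ (including $(a,a)$) together with a pair $(a,\infty)$ for each $a\in P$. It is ordered by the product order $(b_1,d_1)\le_\times(b_2,d_2)\iff b_1\le b_2$ and $d_1\le d_2$, where $p<\infty$ for all $p\in P$. $C_\rho^K$ is the real vector space of simplicial $\rho$-chains of $K$. For a subcomplex $L\subseteq K$, $\mathsf{Z}_\rho(L)$, $\mathsf{B}_\rho(L)$ are the $\rho$-cycles and $\rho$-boundaries of $L$, viewed as subspaces of $C_\rho^K$. $\mathsf{SubCx}(K)$ is the poset of subcomplexes of $K$ under inclusion; a filtration is an order-preserving map $\mathsf{F}:P\to\mathsf{SubCx}(K)$. Birth-death spaces: $\mathsf{ZB}_\rho^{\mathsf{F}}((b,d)) := \mathsf{Z}_\rho(\mathsf{F}(b))\cap\mathsf{B}_\rho(\mathsf{F}(d))$ for $b\le d$ in $P$, $\mathsf{ZB}_\rho^{\mathsf{F}}((b,\infty))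 := \mathsf{Z}_\rho(\mathsf{F}(b))$; with inclusions this is a functor $(\mathsf{Seg}(P),\le_\times)\to\mathsf{Vec}$ (finite-dimensional real vector spaces). Put $W_\rho^{\mathsf{F}}((b,d)) := \sum_{(a,c)<_\times(b,d)}\mathsf{ZB}_\rho^{\mathsf{F}}((a,c))$. The number of independent $\rho$-cycles that are born (precisely) at $b$ and die (precisely) at $d$ is $\dim\big(\mathsf{ZB}_\rho^{\mathsf{F}}((b,d))/W_\rho^{\mathsf{F}}((b,d))\big)$. Möbius homology of a functor $N:R\to\mathsf{Vec}$, $R$ a finite poset: the order complex $\Delta R$ has as $i$-simplices the chains $a_0<\cdots<a_i$ in $R$, faces being subchains. For $r\in R$ let $\Delta R_{\le r}$ (resp. $\Delta R_{<r}$) be the subcomplex of chains whose maximal element is $\le r$ (resp. $<r$). The order cosheaf $\underline{N}$ assigns to a simplex $\sigma$ the space $N(\min\sigma)$, and to a pair $\tau\ge\sigma$ ($\sigma$ a face of $\tau$) the map $N(\min\tau\le\min\sigma)$. For a subcomplex $L\subseteq\Delta R$, $C_s(L;\underline{N}) := \bigoplus_{\sigma\in L,\dim\sigma=s}\underline{N}(\sigma)$, with boundary operator $\partial_s$ sending $x\in\underline{N}(\tau)$, $\dim\tau=s$, to $\sum_{\sigma}[\tau:\sigma]\,\underline{N}(\tau\ge\sigma)(x)$, the sum being over the codimension-one faces $\sigma$ of $\tau$ and $[\tau:\sigma]=\pm1$ the usual incidence signs for a chosen orientation of $\Delta R$. Then $H_s^\downarrow N(r)$ is the $s$-th homology of the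 relative chain complex $C_\bullet(\Delta R_{\le r};\underline{N})/C_\bullet(\Delta R_{<r};\underline{N})$. Here $R=(\mathsf{Seg}(P),\le_\times)$, $N=\mathsf{ZB}_\rho^{\mathsf{F}}$. *)

theory Defs
  imports
    "Jordan_Normal_Form.VS_Connect"
    "HOL-Algebra.AbelCoset"
    "HOL-Combinatorics.Permutations"
    "HOL-Library.Extended"
    "HOL-Library.Product_Order"
begin

section \<open>Real vector spaces as module records\<close>

type_synonym 'a vec_space = "(real, 'a) module"

abbreviation vdim :: "'a vec_space \<Rightarrow> nat" where
  "vdim V \<equiv> vectorspace.dim class_ring V"

definition real_line :: "real vec_space" where
  "real_line = \<lparr>carrier = UNIV, mult = (*), one = 1, zero = 0, add = (+), smult = (*)\<rparr>"

text \<open>The fields \<open>mult\<close> and \<open>one\<close> of a module record play no role for vector spaces.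
  For a finite index set \<open>S\<close>, the product below is the direct sum of the family \<open>A\<close>.\<close>

definition family_sum :: "'i set \<Rightarrow> ('i \<Rightarrow> 'a vec_space) \<Rightarrow> ('i \<Rightarrow> 'a) vec_space" where
  "family_sum S A =
    \<lparr>carrier = (\<Pi>\<^sub>E i\<in>S. carrier (A i)),
     mult = undefined, one = undefined,
     zero = (\<lambda>i\<in>S. \<zero>\<^bsub>A i\<^esub>),
     add = (\<lambda>f g. \<lambda>i\<in>S. f i \<oplus>\<^bsub>A i\<^esub> g i),
     smult = (\<lambda>k f. \<lambda>i\<in>S. k \<odot>\<^bsub>A i\<^esub> f i)\<rparr>"

text \<open>The quotient of \<open>V\<close> by a subspace \<open>U\<close>: its elements are the cosets of \<open>U\<close>. In the scalar
  multiple of a coset \<open>X\<close>, the union is over equal cosets, one for each representative.\<close>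

definition quotient_space :: "'a vec_space \<Rightarrow> 'a set \<Rightarrow> 'a set vec_space" where
  "quotient_space V U =
    \<lparr>carrier = a_rcosets\<^bsub>V\<^esub> U,
     mult = undefined, one = undefined,
     zero = U,
     add = (\<lambda>X Y. X <+>\<^bsub>V\<^esub> Y),
     smult = (\<lambda>k X. \<Union>x\<in>X. U +>\<^bsub>V\<^esub> (k \<odot>\<^bsub>V\<^esub> x))\<rparr>"

text \<open>The map \<open>V/U \<rightarrow> V'/U'\<close> induced by a linear map \<open>f\<close> with \<open>f ` U \<subseteq> U'\<close>.\<close>

definition quotient_map :: "'b vec_space \<Rightarrow> 'b set \<Rightarrow> ('a \<Rightarrow> 'b) \<Rightarrow> 'a set \<Rightarrow> 'b set" where
  "quotient_map V' U' f X = (\<Union>x\<in>X. U' +>\<^bsub>V'\<^esub> f x)"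

definition subspace_family_sum :: "'a vec_space \<Rightarrow> 'i set \<Rightarrow> ('i \<Rightarrow> 'a set) \<Rightarrow> 'a set" where
  "subspace_family_sum V I U = {finsum V x I | x. \<forall>i\<in>I. x i \<in> U i}"

text \<open>Complexes are indexed by the integers, \<open>D s\<close> going from degree \<open>s\<close> to degree \<open>s - 1\<close>.\<close>

definition homology ::
  "(int \<Rightarrow> 'a vec_space) \<Rightarrow> (int \<Rightarrow> 'a \<Rightarrow> 'a) \<Rightarrow> int \<Rightarrow> 'a set vec_space" where
  "homology C D s =
    quotient_space
      ((C s)\<lparr>carrier := {x \<in> carrier (C s). D s x = \<zero>\<^bsub>C (s - 1)\<^esub>}\<rparr>)
      (D (s + 1) ` carrier (C (s + 1)))"


section \<open>Simplicial complexes and cosheaf chains\<close>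

definition simplicial_complex :: "'v set set \<Rightarrow> bool" where
  "simplicial_complex K \<longleftrightarrow>
    (\<forall>\<sigma>\<in>K. finite \<sigma> \<and> \<sigma> \<noteq> {}) \<and> (\<forall>\<tau>\<in>K. \<forall>\<sigma>. \<sigma> \<subseteq> \<tau> \<and> \<sigma> \<noteq> {} \<longrightarrow> \<sigma> \<in> K)"

definition SubCx :: "'v set set \<Rightarrow> 'v set set set" where
  "SubCx K = {L. simplicial_complex L \<and> L \<subseteq> K}"

definition simplices :: "'v set set \<Rightarrow> int \<Rightarrow> 'v set set" where
  "simplices K s = {\<sigma> \<in> K. int (card \<sigma>) - 1 = s}"

text \<open>An orientation picks an ordering of the vertices of each simplex. For \<open>\<tau> = \<sigma> \<union> {v}\<close>, the
  incidence sign compares the ordering of \<open>\<tau>\<close> with that of \<open>\<sigma>\<close> preceded by \<open>v\<close>; if \<open>\<sigma>\<close> inherits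
  its ordering from \<open>\<tau>\<close> and \<open>v\<close> is at position \<open>j\<close> (from 0) of \<open>\<tau>\<close>, this is \<open>(-1)^j\<close>.\<close>

definition orientation :: "'v set set \<Rightarrow> ('v set \<Rightarrow> 'v list) \<Rightarrow> bool" where
  "orientation K \<omega> \<longleftrightarrow> (\<forall>\<sigma>\<in>K. distinct (\<omega> \<sigma>) \<and> set (\<omega> \<sigma>) = \<sigma>)"

definition incidence :: "('v set \<Rightarrow> 'v list) \<Rightarrow> 'v set \<Rightarrow> 'v set \<Rightarrow> real" where
  "incidence \<omega> \<tau> \<sigma> =
    of_int (sign (permutation_of_list (zip (\<omega> \<tau>) ((THE v. v \<in> \<tau> - \<sigma>) # \<omega> \<sigma>))))"

text \<open>A cosheaf on \<open>K\<close> consists of a space \<open>A \<sigma>\<close> for each simplex and a map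
  \<open>e \<tau> \<sigma> : A \<tau> \<rightarrow> A \<sigma>\<close> for each face \<open>\<sigma>\<close> of \<open>\<tau>\<close>.\<close>

definition chain_space :: "'v set set \<Rightarrow> ('v set \<Rightarrow> 'a vec_space) \<Rightarrow> int \<Rightarrow> ('v set \<Rightarrow> 'a) vec_space" where
  "chain_space K A s = family_sum (simplices K s) A"

definition boundary ::
  "'v set set \<Rightarrow> ('v set \<Rightarrow> 'v list) \<Rightarrow> ('v set \<Rightarrow> 'a vec_space) \<Rightarrow> ('v set \<Rightarrow> 'v set \<Rightarrow> 'a \<Rightarrow> 'a)
    \<Rightarrow> int \<Rightarrow> ('v set \<Rightarrow> 'a) \<Rightarrow> ('v set \<Rightarrow> 'a)" where
  "boundary K \<omega> A e s c =
    (\<lambda>\<sigma>\<in>simplices K (s - 1).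
      finsum (A \<sigma>) (\<lambda>\<tau>. incidence \<omega> \<tau> \<sigma> \<odot>\<^bsub>A \<sigma>\<^esub> e \<tau> \<sigma> (c \<tau>)) {\<tau> \<in> simplices K s. \<sigma> \<subset> \<tau>})"

text \<open>The chains of a subcomplex \<open>L \<subseteq> K\<close>, as a subspace of the chains of \<open>K\<close>.\<close>

definition chains_of ::
  "'v set set \<Rightarrow> ('v set \<Rightarrow> 'a vec_space) \<Rightarrow> 'v set set \<Rightarrow> int \<Rightarrow> ('v set \<Rightarrow> 'a) set" where
  "chains_of K A L s =
    {c \<in> carrier (chain_space K A s). \<forall>\<sigma>\<in>simplices K s - L. c \<sigma> = \<zero>\<^bsub>A \<sigma>\<^esub>}"

text \<open>The complex \<open>C(X; A) / C(Y; A)\<close> for subcomplexes \<open>Y \<subseteq> X \<subseteq> K\<close>, and its homology.\<close>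

definition relative_chain_space ::
  "'v set set \<Rightarrow> ('v set \<Rightarrow> 'a vec_space) \<Rightarrow> 'v set set \<Rightarrow> 'v set set \<Rightarrow> int
    \<Rightarrow> ('v set \<Rightarrow> 'a) set vec_space" where
  "relative_chain_space K A X Y s =
    quotient_space ((chain_space K A s)\<lparr>carrier := chains_of K A X s\<rparr>) (chains_of K A Y s)"

definition relative_boundary ::
  "'v set set \<Rightarrow> ('v set \<Rightarrow> 'v list) \<Rightarrow> ('v set \<Rightarrow> 'a vec_space) \<Rightarrow> ('v set \<Rightarrow> 'v set \<Rightarrow> 'a \<Rightarrow> 'a)
    \<Rightarrow> 'v set set \<Rightarrow> 'v set set \<Rightarrow> int \<Rightarrow> ('v set \<Rightarrow> 'a) set \<Rightarrow> ('v set \<Rightarrow> 'a) set" where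
  "relative_boundary K \<omega> A e X Y s =
    quotient_map ((chain_space K A (s - 1))\<lparr>carrier := chains_of K A X (s - 1)\<rparr>)
      (chains_of K A Y (s - 1)) (boundary K \<omega> A e s)"

definition relative_homology ::
  "'v set set \<Rightarrow> ('v set \<Rightarrow> 'v list) \<Rightarrow> ('v set \<Rightarrow> 'a vec_space) \<Rightarrow> ('v set \<Rightarrow> 'v set \<Rightarrow> 'a \<Rightarrow> 'a)
    \<Rightarrow> 'v set set \<Rightarrow> 'v set set \<Rightarrow> int \<Rightarrow> ('v set \<Rightarrow> 'a) set set vec_space" where
  "relative_homology K \<omega> A e X Y =
    homology (relative_chain_space K A X Y) (relative_boundary K \<omega> A e X Y)"


section \<open>Moebius homology\<close>

text \<open>A functor from a finite poset \<open>R\<close> to vector spaces is given by its objects \<open>N r\<close> and its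
  maps \<open>\<phi> r r' : N r \<rightarrow> N r'\<close> for \<open>r \<le> r'\<close>.\<close>

definition order_complex :: "'r::order set \<Rightarrow> 'r set set" where
  "order_complex R =
    {\<sigma>. \<sigma> \<subseteq> R \<and> finite \<sigma> \<and> \<sigma> \<noteq> {} \<and> Complete_Partial_Order.chain (\<le>) \<sigma>}"

definition order_cosheaf :: "('r::order \<Rightarrow> 'a vec_space) \<Rightarrow> 'r set \<Rightarrow> 'a vec_space" where
  "order_cosheaf N \<sigma> = N (LEAST x. x \<in> \<sigma>)"

definition order_cosheaf_map :: "('r::order \<Rightarrow> 'r \<Rightarrow> 'a \<Rightarrow> 'a) \<Rightarrow> 'r set \<Rightarrow> 'r set \<Rightarrow> 'a \<Rightarrow> 'a" where
  "order_cosheaf_map \<phi> \<tau> \<sigma> = \<phi> (LEAST x. x \<in> \<tau>) (LEAST x. x \<in> \<sigma>)"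

definition moebius_homology ::
  "'r::order set \<Rightarrow> ('r set \<Rightarrow> 'r list) \<Rightarrow> ('r \<Rightarrow> 'a vec_space) \<Rightarrow> ('r \<Rightarrow> 'r \<Rightarrow> 'a \<Rightarrow> 'a)
    \<Rightarrow> int \<Rightarrow> 'r \<Rightarrow> ('r set \<Rightarrow> 'a) set set vec_space" where
  "moebius_homology R \<omega> N \<phi> s r =
    relative_homology (order_complex R) \<omega> (order_cosheaf N) (order_cosheaf_map \<phi>)
      {\<sigma> \<in> order_complex R. (GREATEST x. x \<in> \<sigma>) \<le> r}
      {\<sigma> \<in> order_complex R. (GREATEST x. x \<in> \<sigma>) < r} s"


section \<open>Segments, filtrations and birth-death spaces\<close>

text \<open>The point \<open>\<infinity>\<close> is \<open>Pinf\<close>; the bottom element \<open>Minf\<close> of \<^typ>\<open>'p extended\<close> occurs in no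
  segment. The order on pairs is the product order.\<close>

definition Seg :: "'p::order set \<Rightarrow> ('p \<times> 'p extended) set" where
  "Seg P = {(b, Fin d) | b d. b \<in> P \<and> d \<in> P \<and> b \<le> d} \<union> {(a, Pinf) | a. a \<in> P}"

definition filtration :: "'p::order set \<Rightarrow> 'v set set \<Rightarrow> ('p \<Rightarrow> 'v set set) \<Rightarrow> bool" where
  "filtration P K F \<longleftrightarrow> F ` P \<subseteq> SubCx K \<and> mono_on P F"

text \<open>Real simplicial chains are the chains of the constant cosheaf \<open>\<real>\<close>.\<close>

definition simp_chain_space :: "'v set set \<Rightarrow> int \<Rightarrow> ('v set \<Rightarrow> real) vec_space" where
  "simp_chain_space K = chain_space K (\<lambda>_. real_line)"

definition simp_boundary ::
  "'v set set \<Rightarrow> ('v set \<Rightarrow> 'v list) \<Rightarrow> int \<Rightarrow> ('v set \<Rightarrow> real) \<Rightarrow> ('v set \<Rightarrow> real)" where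
  "simp_boundary K \<omega> = boundary K \<omega> (\<lambda>_. real_line) (\<lambda>_ _ x. x)"

definition cycles ::
  "'v set set \<Rightarrow> ('v set \<Rightarrow> 'v list) \<Rightarrow> int \<Rightarrow> 'v set set \<Rightarrow> ('v set \<Rightarrow> real) set" where
  "cycles K \<omega> \<rho> L =
    {c \<in> chains_of K (\<lambda>_. real_line) L \<rho>. simp_boundary K \<omega> \<rho> c = \<zero>\<^bsub>simp_chain_space K (\<rho> - 1)\<^esub>}"

definition boundaries ::
  "'v set set \<Rightarrow> ('v set \<Rightarrow> 'v list) \<Rightarrow> int \<Rightarrow> 'v set set \<Rightarrow> ('v set \<Rightarrow> real) set" where
  "boundaries K \<omega> \<rho> L =
    simp_boundary K \<omega> (\<rho> + 1) ` chains_of K (\<lambda>_. real_line) L (\<rho> + 1)"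

definition ZB_set ::
  "'v set set \<Rightarrow> ('v set \<Rightarrow> 'v list) \<Rightarrow> ('p::order \<Rightarrow> 'v set set) \<Rightarrow> int \<Rightarrow> 'p \<times> 'p extended
    \<Rightarrow> ('v set \<Rightarrow> real) set" where
  "ZB_set K \<omega> F \<rho> s = (case s of
      (b, Fin d) \<Rightarrow> cycles K \<omega> \<rho> (F b) \<inter> boundaries K \<omega> \<rho> (F d)
    | (b, Pinf) \<Rightarrow> cycles K \<omega> \<rho> (F b))"

definition ZB ::
  "'v set set \<Rightarrow> ('v set \<Rightarrow> 'v list) \<Rightarrow> ('p::order \<Rightarrow> 'v set set) \<Rightarrow> int \<Rightarrow> 'p \<times> 'p extended
    \<Rightarrow> ('v set \<Rightarrow> real) vec_space" where
  "ZB K \<omega> F \<rho> s = (simp_chain_space K \<rho>)\<lparr>carrier := ZB_set K \<omega> F \<rho> s\<rparr>"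

text \<open>All maps of the functor \<open>ZB\<close> are inclusions of subspaces of the space of chains.\<close>

definition ZB_map :: "'p \<times> 'p extended \<Rightarrow> 'p \<times> 'p extended \<Rightarrow> ('v set \<Rightarrow> real) \<Rightarrow> ('v set \<Rightarrow> real)" where
  "ZB_map s t = (\<lambda>x. x)"

definition W ::
  "'p::order set \<Rightarrow> 'v set set \<Rightarrow> ('v set \<Rightarrow> 'v list) \<Rightarrow> ('p \<Rightarrow> 'v set set) \<Rightarrow> int \<Rightarrow> 'p \<times> 'p extended
    \<Rightarrow> ('v set \<Rightarrow> real) set" where
  "W P K \<omega> F \<rho> s =
    subspace_family_sum (simp_chain_space K \<rho>) {t \<in> Seg P. t < s} (ZB_set K \<omega> F \<rho>)"

text \<open>The number of independent \<open>\<rho>\<close>-cycles born precisely at \<open>b\<close> and dying precisely at \<open>d\<close>,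
  for the segment \<open>s = (b, d)\<close>.\<close>

definition born_dying ::
  "'p::order set \<Rightarrow> 'v set set \<Rightarrow> ('v set \<Rightarrow> 'v list) \<Rightarrow> ('p \<Rightarrow> 'v set set) \<Rightarrow> int \<Rightarrow> 'p \<times> 'p extended
    \<Rightarrow> nat" where
  "born_dying P K \<omega> F \<rho> s = vdim (quotient_space (ZB K \<omega> F \<rho> s) (W P K \<omega> F \<rho> s))"

end

theory Submission
  imports Defs
begin

text \<open>
  The theorem is an instance of a fact about all functors \<open>N\<close> from a finite poset \<open>R\<close> to
  vector spaces: the zeroth Moebius homology at \<open>r\<close> is the quotient of \<open>N r\<close> by the sum of the
  images of \<open>N a\<close> for \<open>a < r\<close> (\<open>vdim_moebius_homology_0\<close>).

  To see this, restrict attention to the simplices whose maximum is exactly \<open>r\<close>, as the others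
  vanish in the relative complex. The only such vertex is \<open>{r}\<close>, with coefficients in \<open>N r\<close>. Such
  edges are the pairs \<open>{a, r}\<close> with \<open>a < r\<close>, with coefficients in \<open>N a\<close>. The boundary of an edge
  has two terms: the one at \<open>{a}\<close> vanishes in the relative complex, and the one at \<open>{r}\<close> is, up to
  sign, the image in \<open>N r\<close> of the coefficient. In degree \<open>0\<close> everything is a cycle. So the homology
  is the cokernel of \<open>(\<Oplus>a<r. N a) \<rightarrow> N r\<close>.

  For the birth-death functor all maps are inclusions. The sum of the images is then the
  sum of the birth-death spaces of strictly smaller segments, which is \<open>W\<close>, and the quotient is
  the one that counts the cycles born at \<open>b\<close> and dying at \<open>d\<close>. That \<open>ZB\<close> is a functor follows from
  linearity of the boundary operator (\<open>subspace_ZB_set\<close>) and monotonicity of the filtration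
  (\<open>ZB_set_mono\<close>).

  Homology is an iterated quotient whose elements are sets of cosets. The comparison is
  therefore made once, in \<open>vdim_iterated_quotient\<close>, from a surjective linear map on the
  chains themselves: evaluation at \<open>{r}\<close>.
\<close>


section \<open>Vector spaces, subspaces and sums\<close>

lemma vectorspaceI:
  fixes V :: "'a vec_space"
  assumes "\<And>x y. x \<in> carrier V \<Longrightarrow> y \<in> carrier V \<Longrightarrow> x \<oplus>\<^bsub>V\<^esub> y \<in> carrier V"
    and "\<zero>\<^bsub>V\<^esub> \<in> carrier V"
    and "\<And>x y z. x \<in> carrier V \<Longrightarrow> y \<in> carrier V \<Longrightarrow> z \<in> carrier V \<Longrightarrow>
          (x \<oplus>\<^bsub>V\<^esub> y) \<oplus>\<^bsub>V\<^esub> z = x \<oplus>\<^bsub>V\<^esub> (y \<oplus>\<^bsub>V\<^esub> z)"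
    and "\<And>x y. x \<in> carrier V \<Longrightarrow> y \<in> carrier V \<Longrightarrow> x \<oplus>\<^bsub>V\<^esub> y = y \<oplus>\<^bsub>V\<^esub> x"
    and "\<And>x. x \<in> carrier V \<Longrightarrow> \<zero>\<^bsub>V\<^esub> \<oplus>\<^bsub>V\<^esub> x = x"
    and "\<And>x. x \<in> carrier V \<Longrightarrow> (- 1) \<odot>\<^bsub>V\<^esub> x \<oplus>\<^bsub>V\<^esub> x = \<zero>\<^bsub>V\<^esub>"
    and "\<And>k x. x \<in> carrier V \<Longrightarrow> k \<odot>\<^bsub>V\<^esub> x \<in> carrier V"
    and "\<And>k l x. x \<in> carrier V \<Longrightarrow> (k + l) \<odot>\<^bsub>V\<^esub> x = k \<odot>\<^bsub>V\<^esub> x \<oplus>\<^bsub>V\<^esub> l \<odot>\<^bsub>V\<^esub> x"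
    and "\<And>k x y. x \<in> carrier V \<Longrightarrow> y \<in> carrier V \<Longrightarrow>
          k \<odot>\<^bsub>V\<^esub> (x \<oplus>\<^bsub>V\<^esub> y) = k \<odot>\<^bsub>V\<^esub> x \<oplus>\<^bsub>V\<^esub> k \<odot>\<^bsub>V\<^esub> y"
    and "\<And>k l x. x \<in> carrier V \<Longrightarrow> (k * l) \<odot>\<^bsub>V\<^esub> x = k \<odot>\<^bsub>V\<^esub> (l \<odot>\<^bsub>V\<^esub> x)"
    and "\<And>x. x \<in> carrier V \<Longrightarrow> 1 \<odot>\<^bsub>V\<^esub> x = x"
  shows "vectorspace class_ring V"
proof -
  have "abelian_group V"
  proof (rule abelian_groupI)
    show "\<exists>y\<in>carrier V. y \<oplus>\<^bsub>V\<^esub> x = \<zero>\<^bsub>V\<^esub>" if "x \<in> carrier V" for x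
      using assms(6,7)[OF that] by blast
  qed (fact assms(1-5))+
  then have "module class_ring V"
    by (intro moduleI) (simp_all add: class_field fieldE(1) assms(7-11))
  then show ?thesis
    by (simp add: vectorspace_def class_field)
qed

lemma vectorspaceD:
  fixes V :: "'a vec_space"
  assumes "vectorspace class_ring V"
  shows "\<And>x y. x \<in> carrier V \<Longrightarrow> y \<in> carrier V \<Longrightarrow> x \<oplus>\<^bsub>V\<^esub> y \<in> carrier V"
    and "\<zero>\<^bsub>V\<^esub> \<in> carrier V"
    and "\<And>x y z. x \<in> carrier V \<Longrightarrow> y \<in> carrier V \<Longrightarrow> z \<in> carrier V \<Longrightarrow>
          (x \<oplus>\<^bsub>V\<^esub> y) \<oplus>\<^bsub>V\<^esub> z = x \<oplus>\<^bsub>V\<^esub> (y \<oplus>\<^bsub>V\<^esub> z)"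
    and "\<And>x y. x \<in> carrier V \<Longrightarrow> y \<in> carrier V \<Longrightarrow> x \<oplus>\<^bsub>V\<^esub> y = y \<oplus>\<^bsub>V\<^esub> x"
    and "\<And>x. x \<in> carrier V \<Longrightarrow> \<zero>\<^bsub>V\<^esub> \<oplus>\<^bsub>V\<^esub> x = x"
    and "\<And>x. x \<in> carrier V \<Longrightarrow> (- 1) \<odot>\<^bsub>V\<^esub> x \<oplus>\<^bsub>V\<^esub> x = \<zero>\<^bsub>V\<^esub>"
    and "\<And>k x. x \<in> carrier V \<Longrightarrow> k \<odot>\<^bsub>V\<^esub> x \<in> carrier V"
    and "\<And>k l x. x \<in> carrier V \<Longrightarrow> (k + l) \<odot>\<^bsub>V\<^esub> x = k \<odot>\<^bsub>V\<^esub> x \<oplus>\<^bsub>V\<^esub> l \<odot>\<^bsub>V\<^esub> x"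
    and "\<And>k x y. x \<in> carrier V \<Longrightarrow> y \<in> carrier V \<Longrightarrow>
          k \<odot>\<^bsub>V\<^esub> (x \<oplus>\<^bsub>V\<^esub> y) = k \<odot>\<^bsub>V\<^esub> x \<oplus>\<^bsub>V\<^esub> k \<odot>\<^bsub>V\<^esub> y"
    and "\<And>k l x. x \<in> carrier V \<Longrightarrow> (k * l) \<odot>\<^bsub>V\<^esub> x = k \<odot>\<^bsub>V\<^esub> (l \<odot>\<^bsub>V\<^esub> x)"
    and "\<And>x. x \<in> carrier V \<Longrightarrow> 1 \<odot>\<^bsub>V\<^esub> x = x"
    and "\<And>k. k \<odot>\<^bsub>V\<^esub> \<zero>\<^bsub>V\<^esub> = \<zero>\<^bsub>V\<^esub>"
proof -
  interpret V: vectorspace class_ring V by fact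
  show "\<And>x. x \<in> carrier V \<Longrightarrow> (- 1) \<odot>\<^bsub>V\<^esub> x \<oplus>\<^bsub>V\<^esub> x = \<zero>\<^bsub>V\<^esub>"
    using V.smult_minus_1 by (simp add: class_ring_simps V.M.l_neg)
  show "\<And>k. k \<odot>\<^bsub>V\<^esub> \<zero>\<^bsub>V\<^esub> = \<zero>\<^bsub>V\<^esub>"
    by simp
qed (use assms in \<open>auto simp: vectorspace_def Module.module_def module_axioms_def
      abelian_group_def abelian_monoid.a_closed abelian_monoid.zero_closed
      abelian_monoid.a_assoc abelian_monoid.l_zero
      intro: abelian_monoid.a_comm\<close>)

lemma linear_mapI:
  fixes V :: "'a vec_space" and W :: "'b vec_space"
  assumes "vectorspace class_ring V" "vectorspace class_ring W"
    and "\<And>x. x \<in> carrier V \<Longrightarrow> f x \<in> carrier W"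
    and "\<And>x y. x \<in> carrier V \<Longrightarrow> y \<in> carrier V \<Longrightarrow> f (x \<oplus>\<^bsub>V\<^esub> y) = f x \<oplus>\<^bsub>W\<^esub> f y"
    and "\<And>k x. x \<in> carrier V \<Longrightarrow> f (k \<odot>\<^bsub>V\<^esub> x) = k \<odot>\<^bsub>W\<^esub> f x"
  shows "linear_map class_ring V W f"
  using assms
  by (auto simp: linear_map_def mod_hom_def mod_hom_axioms_def vectorspace_def
      LinearCombinations.module_hom_def)

lemma subspaceI:
  fixes V :: "'a vec_space"
  assumes "vectorspace class_ring V" "U \<subseteq> carrier V" "\<zero>\<^bsub>V\<^esub> \<in> U"
    and "\<And>x y. x \<in> U \<Longrightarrow> y \<in> U \<Longrightarrow> x \<oplus>\<^bsub>V\<^esub> y \<in> U"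
    and "\<And>k x. x \<in> U \<Longrightarrow> k \<odot>\<^bsub>V\<^esub> x \<in> U"
  shows "VectorSpace.subspace class_ring U V"
  using assms by (auto simp: VectorSpace.subspace_def LinearCombinations.submodule_def vectorspace_def)

text \<open>The vector space axioms are equations, so they pass to any structure onto which a
  vector space is mapped compatibly with the operations. Applied to the projection onto cosets,
  this shows that quotients are vector spaces without computing with sets of representatives.\<close>

lemma linear_map_onto:
  fixes V :: "'a vec_space" and Q :: "'b vec_space"
  assumes "vectorspace class_ring V"
    and onto: "p ` carrier V = carrier Q"
    and zero: "p \<zero>\<^bsub>V\<^esub> = \<zero>\<^bsub>Q\<^esub>"
    and add: "\<And>x y. x \<in> carrier V \<Longrightarrow> y \<in> carrier V \<Longrightarrow> p (x \<oplus>\<^bsub>V\<^esub> y) = p x \<oplus>\<^bsub>Q\<^esub> p y"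
    and smult: "\<And>k x. x \<in> carrier V \<Longrightarrow> p (k \<odot>\<^bsub>V\<^esub> x) = k \<odot>\<^bsub>Q\<^esub> p x"
  shows "linear_map class_ring V Q p"
proof -
  interpret V: vectorspace class_ring V by fact
  have pQ: "\<exists>x\<in>carrier V. y = p x" if "y \<in> carrier Q" for y
    using that onto by blast
  have Qp: "p x \<in> carrier Q" if "x \<in> carrier V" for x
    using that onto by blast
  have neg: "(- 1) \<odot>\<^bsub>V\<^esub> x \<oplus>\<^bsub>V\<^esub> x = \<zero>\<^bsub>V\<^esub>" if "x \<in> carrier V" for x
    using that V.smult_minus_1[of x] by (simp add: class_ring_simps V.M.l_neg)
  have smc: "k \<odot>\<^bsub>V\<^esub> x \<in> carrier V" if "x \<in> carrier V" for k x
    using that by simp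
  have "vectorspace class_ring Q"
  proof (rule vectorspaceI)
    show "x \<oplus>\<^bsub>Q\<^esub> y \<in> carrier Q" if xy: "x \<in> carrier Q" "y \<in> carrier Q" for x y
      using pQ[OF xy(1)] pQ[OF xy(2)] by (auto simp flip: add intro!: Qp)
    show "\<zero>\<^bsub>Q\<^esub> \<in> carrier Q"
      by (simp flip: zero add: Qp)
    show "(x \<oplus>\<^bsub>Q\<^esub> y) \<oplus>\<^bsub>Q\<^esub> z = x \<oplus>\<^bsub>Q\<^esub> (y \<oplus>\<^bsub>Q\<^esub> z)"
      if xyz: "x \<in> carrier Q" "y \<in> carrier Q" "z \<in> carrier Q" for x y z
      using pQ[OF xyz(1)] pQ[OF xyz(2)] pQ[OF xyz(3)] by (auto simp flip: add simp: V.M.a_assoc)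
    show "x \<oplus>\<^bsub>Q\<^esub> y = y \<oplus>\<^bsub>Q\<^esub> x" if xy: "x \<in> carrier Q" "y \<in> carrier Q" for x y
      using pQ[OF xy(1)] pQ[OF xy(2)] by (auto simp flip: add simp: V.M.a_comm)
    show "\<zero>\<^bsub>Q\<^esub> \<oplus>\<^bsub>Q\<^esub> x = x" if x: "x \<in> carrier Q" for x
      using pQ[OF x] by (auto simp flip: add zero)
    show "(- 1) \<odot>\<^bsub>Q\<^esub> x \<oplus>\<^bsub>Q\<^esub> x = \<zero>\<^bsub>Q\<^esub>" if x: "x \<in> carrier Q" for x
      using pQ[OF x] neg smc by (auto simp flip: add zero smult)
    show "k \<odot>\<^bsub>Q\<^esub> x \<in> carrier Q" if x: "x \<in> carrier Q" for k x
      using pQ[OF x] by (auto simp flip: smult intro!: Qp)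
    show "(k + l) \<odot>\<^bsub>Q\<^esub> x = k \<odot>\<^bsub>Q\<^esub> x \<oplus>\<^bsub>Q\<^esub> l \<odot>\<^bsub>Q\<^esub> x" if x: "x \<in> carrier Q" for k l x
      using pQ[OF x] V.smult_l_distr by (auto simp flip: add smult)
    show "k \<odot>\<^bsub>Q\<^esub> (x \<oplus>\<^bsub>Q\<^esub> y) = k \<odot>\<^bsub>Q\<^esub> x \<oplus>\<^bsub>Q\<^esub> k \<odot>\<^bsub>Q\<^esub> y"
      if xy: "x \<in> carrier Q" "y \<in> carrier Q" for k x y
      using pQ[OF xy(1)] pQ[OF xy(2)] V.smult_r_distr by (auto simp flip: add smult)
    show "(k * l) \<odot>\<^bsub>Q\<^esub> x = k \<odot>\<^bsub>Q\<^esub> (l \<odot>\<^bsub>Q\<^esub> x)" if x: "x \<in> carrier Q" for k l x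
      using pQ[OF x] V.smult_assoc1 by (auto simp flip: smult)
    show "1 \<odot>\<^bsub>Q\<^esub> x = x" if x: "x \<in> carrier Q" for x
      using pQ[OF x] V.smult_one by (auto simp flip: smult)
  qed
  then show ?thesis
    using assms by (intro linear_mapI) auto
qed

lemma subspace_Int:
  assumes "VectorSpace.subspace class_ring U V" "VectorSpace.subspace class_ring U' V"
  shows "VectorSpace.subspace class_ring (U \<inter> U') V"
  using assms by (auto simp: VectorSpace.subspace_def LinearCombinations.submodule_def)

lemma subspace_image:
  fixes V :: "'a vec_space" and W :: "'b vec_space"
  assumes f: "linear_map class_ring V W f" and U: "VectorSpace.subspace class_ring U V"
  shows "VectorSpace.subspace class_ring (f ` U) W"
proof -
  interpret f: linear_map class_ring V W f by fact
  have Us: "U \<subseteq> carrier V" "\<zero>\<^bsub>V\<^esub> \<in> U" "\<And>x y. x \<in> U \<Longrightarrow> y \<in> U \<Longrightarrow> x \<oplus>\<^bsub>V\<^esub> y \<in> U"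
    "\<And>k x. x \<in> U \<Longrightarrow> k \<odot>\<^bsub>V\<^esub> x \<in> U"
    using U by (auto simp: VectorSpace.subspace_def LinearCombinations.submodule_def)
  show ?thesis
  proof (rule subspaceI)
    show "vectorspace class_ring W"
      by unfold_locales
    show "f ` U \<subseteq> carrier W"
      using Us(1) f.T_im by blast
    show "\<zero>\<^bsub>W\<^esub> \<in> f ` U"
      using f.T0_is_0 Us(2) by (metis image_eqI)
  next
    fix x y assume "x \<in> f ` U" "y \<in> f ` U"
    then obtain u v where uv: "u \<in> U" "v \<in> U" "x = f u" "y = f v"
      by blast
    then have "x \<oplus>\<^bsub>W\<^esub> y = f (u \<oplus>\<^bsub>V\<^esub> v)"
      using f.T_add[of u v] Us(1) by (simp add: subset_iff)
    then show "x \<oplus>\<^bsub>W\<^esub> y \<in> f ` U"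
      using uv Us(3) by blast
  next
    fix k x assume "x \<in> f ` U"
    then obtain u where u: "u \<in> U" "x = f u"
      by blast
    then have "k \<odot>\<^bsub>W\<^esub> x = f (k \<odot>\<^bsub>V\<^esub> u)"
      using f.T_smult[of k u] Us(1) by (simp add: subset_iff)
    then show "k \<odot>\<^bsub>W\<^esub> x \<in> f ` U"
      using u Us(4) by blast
  qed
qed

text \<open>The definition of \<open>finsum\<close> refers to the carrier, so a sum of elements of a
  subspace has to be compared with the sum in the ambient space.\<close>

lemma finsum_subspace:
  fixes V :: "'a vec_space"
  assumes U: "VectorSpace.subspace class_ring U V" and x: "x \<in> I \<rightarrow> U"
  shows "finsum (V\<lparr>carrier := U\<rparr>) x I = finsum V x I"
proof -
  have V: "vectorspace class_ring V" and UV: "U \<subseteq> carrier V"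
    using U by (auto simp: VectorSpace.subspace_def LinearCombinations.submodule_def)
  interpret V: vectorspace class_ring V by fact
  interpret U: vectorspace class_ring "V\<lparr>carrier := U\<rparr>"
    using U by (rule V.subspace_is_vs)
  show ?thesis
    using x
  proof (induction I rule: infinite_finite_induct)
    case (insert i I)
    have xU: "x \<in> I \<rightarrow> carrier (V\<lparr>carrier := U\<rparr>)" "x i \<in> carrier (V\<lparr>carrier := U\<rparr>)"
      using insert.prems by auto
    have xV: "x \<in> I \<rightarrow> carrier V" "x i \<in> carrier V"
      using insert.prems UV by auto
    have "finsum (V\<lparr>carrier := U\<rparr>) x I = finsum V x I"
      using insert.IH insert.prems by blast
    then show ?case
      using U.M.finsum_insert[OF insert.hyps xU] V.M.finsum_insert[OF insert.hyps xV] by simp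
  qed simp_all
qed

lemma finsum_eq_zero:
  fixes V :: "'a vec_space"
  assumes "vectorspace class_ring V" "\<And>i. i \<in> I \<Longrightarrow> f i = \<zero>\<^bsub>V\<^esub>"
  shows "finsum V f I = \<zero>\<^bsub>V\<^esub>"
proof -
  interpret V: vectorspace class_ring V by fact
  have "finsum V f I = finsum V (\<lambda>_. \<zero>\<^bsub>V\<^esub>) I"
    by (rule V.M.finsum_cong'[OF refl]) (use assms(2) in auto)
  then show ?thesis
    by simp
qed

lemma subspace_subspace_family_sum:
  fixes V :: "'a vec_space"
  assumes V: "vectorspace class_ring V"
    and U: "\<And>i. i \<in> I \<Longrightarrow> VectorSpace.subspace class_ring (U i) V"
  shows "VectorSpace.subspace class_ring (subspace_family_sum V I U) V"
proof -
  interpret V: vectorspace class_ring V by fact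
  have Us: "U i \<subseteq> carrier V" "\<zero>\<^bsub>V\<^esub> \<in> U i" "\<And>x y. x \<in> U i \<Longrightarrow> y \<in> U i \<Longrightarrow> x \<oplus>\<^bsub>V\<^esub> y \<in> U i"
    "\<And>k x. x \<in> U i \<Longrightarrow> k \<odot>\<^bsub>V\<^esub> x \<in> U i" if "i \<in> I" for i
    using U[OF that] by (auto simp: VectorSpace.subspace_def LinearCombinations.submodule_def)
  have mem: "x \<in> I \<rightarrow> carrier V" if "\<forall>i\<in>I. x i \<in> U i" for x
    using that Us(1) by blast
  show ?thesis
  proof (rule subspaceI[OF V])
    show "subspace_family_sum V I U \<subseteq> carrier V"
      using mem by (auto simp: subspace_family_sum_def intro: V.M.finsum_closed)
    have "\<zero>\<^bsub>V\<^esub> = finsum V (\<lambda>_. \<zero>\<^bsub>V\<^esub>) I"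
      by simp
    then show "\<zero>\<^bsub>V\<^esub> \<in> subspace_family_sum V I U"
      unfolding subspace_family_sum_def using Us(2) by blast
  next
    fix v w assume "v \<in> subspace_family_sum V I U" "w \<in> subspace_family_sum V I U"
    then obtain x y where xy: "v = finsum V x I" "\<forall>i\<in>I. x i \<in> U i" "w = finsum V y I" "\<forall>i\<in>I. y i \<in> U i"
      unfolding subspace_family_sum_def by blast
    then have "v \<oplus>\<^bsub>V\<^esub> w = finsum V (\<lambda>i. x i \<oplus>\<^bsub>V\<^esub> y i) I"
      using V.M.finsum_addf[OF mem mem] by simp
    then show "v \<oplus>\<^bsub>V\<^esub> w \<in> subspace_family_sum V I U"
      unfolding subspace_family_sum_def using xy Us(3) by blast
  next
    fix k v assume "v \<in> subspace_family_sum V I U"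
    then obtain x where x: "v = finsum V x I" "\<forall>i\<in>I. x i \<in> U i"
      unfolding subspace_family_sum_def by blast
    then have "k \<odot>\<^bsub>V\<^esub> v = finsum V (\<lambda>i. k \<odot>\<^bsub>V\<^esub> x i) I"
      using V.finsum_smult[OF _ mem] by simp
    then show "k \<odot>\<^bsub>V\<^esub> v \<in> subspace_family_sum V I U"
      unfolding subspace_family_sum_def using x Us(4) by blast
  qed
qed

section \<open>Quotients and their dimension\<close>

lemma subspace_abelian_subgroup:
  fixes V :: "'a vec_space"
  assumes "VectorSpace.subspace class_ring U V"
  shows "abelian_subgroup U V"
proof -
  interpret V: vectorspace class_ring V
    using assms by (simp add: VectorSpace.subspace_def)
  have U: "LinearCombinations.submodule class_ring U V"
    using assms by (simp add: VectorSpace.subspace_def)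
  have "subgroup U (add_monoid V)"
  proof (rule subgroup.intro)
    show "U \<subseteq> carrier (add_monoid V)"
      using U by (simp add: LinearCombinations.submodule_def)
    show "\<And>x y. x \<in> U \<Longrightarrow> y \<in> U \<Longrightarrow> x \<otimes>\<^bsub>add_monoid V\<^esub> y \<in> U" "\<one>\<^bsub>add_monoid V\<^esub> \<in> U"
      using U by (auto simp: LinearCombinations.submodule_def)
    fix x assume x: "x \<in> U"
    then have "(- 1) \<odot>\<^bsub>V\<^esub> x \<in> U" "x \<in> carrier V"
      using U by (auto simp: LinearCombinations.submodule_def)
    then have "\<ominus>\<^bsub>V\<^esub> x \<in> U"
      using V.smult_minus_1[of x] by (simp add: class_ring_simps)
    then show "inv\<^bsub>add_monoid V\<^esub> x \<in> U"
      by (simp add: a_inv_def)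
  qed
  then show ?thesis
    by (intro abelian_subgroupI3 additive_subgroupI V.abelian_group_axioms)
qed

lemma coset_eq_iff:
  fixes V :: "'a vec_space"
  assumes "VectorSpace.subspace class_ring U V" "x \<in> carrier V" "y \<in> carrier V"
  shows "U +>\<^bsub>V\<^esub> x = U +>\<^bsub>V\<^esub> y \<longleftrightarrow> x \<ominus>\<^bsub>V\<^esub> y \<in> U"
proof -
  interpret U: abelian_subgroup U V
    using assms(1) by (rule subspace_abelian_subgroup)
  show ?thesis
  proof
    assume "U +>\<^bsub>V\<^esub> x = U +>\<^bsub>V\<^esub> y"
    then have "x \<in> U +>\<^bsub>V\<^esub> y"
      using U.a_rcos_self[OF assms(2)] by simp
    then show "x \<ominus>\<^bsub>V\<^esub> y \<in> U"
      using U.a_rcos_module_imp[OF assms(3)] by (simp add: a_minus_def)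
  next
    assume "x \<ominus>\<^bsub>V\<^esub> y \<in> U"
    then have "x \<in> U +>\<^bsub>V\<^esub> y"
      using U.a_rcos_module_rev[OF assms(3,2)] by (simp only: a_minus_def)
    then show "U +>\<^bsub>V\<^esub> x = U +>\<^bsub>V\<^esub> y"
      using U.a_repr_independence' assms(3) by blast
  qed
qed

text \<open>Scalar multiplication of a coset is a union over its elements; the union has only one
  term, because two elements of a coset differ by a member of \<open>U\<close> and so do their
  multiples.\<close>

lemma quotient_projection:
  fixes V :: "'a vec_space"
  assumes U: "VectorSpace.subspace class_ring U V"
  shows "linear_map class_ring V (quotient_space V U) (\<lambda>x. U +>\<^bsub>V\<^esub> x)"
proof (rule linear_map_onto)
  show V: "vectorspace class_ring V"
    using assms by (simp add: VectorSpace.subspace_def)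
  interpret V: vectorspace class_ring V by fact
  interpret U: abelian_subgroup U V
    using assms(1) by (rule subspace_abelian_subgroup)
  have Uc: "U \<subseteq> carrier V" by (rule U.a_subset)
  show "(\<lambda>x. U +>\<^bsub>V\<^esub> x) ` carrier V = carrier (quotient_space V U)"
    by (auto simp: quotient_space_def A_RCOSETS_def')
  show "U +>\<^bsub>V\<^esub> \<zero>\<^bsub>V\<^esub> = \<zero>\<^bsub>quotient_space V U\<^esub>"
    using Uc by (simp add: quotient_space_def V.M.a_coset_add_zero)
  show "U +>\<^bsub>V\<^esub> (x \<oplus>\<^bsub>V\<^esub> y) = (U +>\<^bsub>V\<^esub> x) \<oplus>\<^bsub>quotient_space V U\<^esub> (U +>\<^bsub>V\<^esub> y)"
    if "x \<in> carrier V" "y \<in> carrier V" for x y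
    using that by (simp add: quotient_space_def U.a_rcos_sum)
  show "U +>\<^bsub>V\<^esub> (k \<odot>\<^bsub>V\<^esub> x) = k \<odot>\<^bsub>quotient_space V U\<^esub> (U +>\<^bsub>V\<^esub> x)" if x: "x \<in> carrier V" for k x
  proof -
    have "U +>\<^bsub>V\<^esub> (k \<odot>\<^bsub>V\<^esub> y) = U +>\<^bsub>V\<^esub> (k \<odot>\<^bsub>V\<^esub> x)" if y: "y \<in> U +>\<^bsub>V\<^esub> x" for y
    proof -
      have yc: "y \<in> carrier V" and "U +>\<^bsub>V\<^esub> y = U +>\<^bsub>V\<^esub> x"
        using y x U.a_elemrcos_carrier U.a_repr_independence' by auto
      then have "y \<ominus>\<^bsub>V\<^esub> x \<in> U"
        using coset_eq_iff[OF U yc x] by simp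
      then have "k \<odot>\<^bsub>V\<^esub> (y \<ominus>\<^bsub>V\<^esub> x) \<in> U"
        using U by (auto simp: VectorSpace.subspace_def LinearCombinations.submodule_def)
      moreover have "k \<odot>\<^bsub>V\<^esub> (y \<ominus>\<^bsub>V\<^esub> x) = k \<odot>\<^bsub>V\<^esub> y \<ominus>\<^bsub>V\<^esub> k \<odot>\<^bsub>V\<^esub> x"
        using x yc by (simp add: a_minus_def V.smult_r_distr V.smult_r_minus)
      ultimately show ?thesis
        using coset_eq_iff[OF U, of "k \<odot>\<^bsub>V\<^esub> y" "k \<odot>\<^bsub>V\<^esub> x"] x yc by simp
    qed
    then have "(\<Union>y\<in>U +>\<^bsub>V\<^esub> x. U +>\<^bsub>V\<^esub> (k \<odot>\<^bsub>V\<^esub> y)) = (\<Union>y\<in>U +>\<^bsub>V\<^esub> x. U +>\<^bsub>V\<^esub> (k \<odot>\<^bsub>V\<^esub> x))"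
      by (rule SUP_cong[OF refl])
    then show ?thesis
      using U.a_rcos_self[OF x] by (auto simp: quotient_space_def)
  qed
qed

lemma carrier_quotient_space:
  "carrier (quotient_space V U) = (\<lambda>x. U +>\<^bsub>V\<^esub> x) ` carrier V"
  by (auto simp: quotient_space_def A_RCOSETS_def')

lemma linear_map_inv:
  fixes V :: "'a vec_space" and W :: "'b vec_space"
  assumes "linear_map class_ring V W f" and bij: "bij_betw f (carrier V) (carrier W)"
  shows "linear_map class_ring W V (inv_into (carrier V) f)"
proof -
  interpret f: linear_map class_ring V W f by fact
  let ?g = "inv_into (carrier V) f"
  have g: "?g y \<in> carrier V" "f (?g y) = y" if "y \<in> carrier W" for y
    using bij that by (auto simp: bij_betw_def inv_into_into f_inv_into_f)
  have gf: "?g (f x) = x" if "x \<in> carrier V" for x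
    using bij that by (auto simp: bij_betw_def)
  show ?thesis
  proof (rule linear_mapI)
    show "vectorspace class_ring W" "vectorspace class_ring V"
      by unfold_locales
    show "?g y \<in> carrier V" if "y \<in> carrier W" for y
      using g that by blast
    show "?g (x \<oplus>\<^bsub>W\<^esub> y) = ?g x \<oplus>\<^bsub>V\<^esub> ?g y" if "x \<in> carrier W" "y \<in> carrier W" for x y
      using gf[of "?g x \<oplus>\<^bsub>V\<^esub> ?g y"] g that by simp
    show "?g (k \<odot>\<^bsub>W\<^esub> x) = k \<odot>\<^bsub>V\<^esub> ?g x" if "x \<in> carrier W" for k x
      using gf[of "k \<odot>\<^bsub>V\<^esub> ?g x"] g that by simp
  qed
qed

text \<open>A bijective linear map carries finite spanning sets to finite spanning sets. If there are
  none, \<open>vdim\<close> is on both sides the least element of the empty set of numbers.\<close>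

lemma vdim_eq_of_bij:
  fixes V :: "'a vec_space" and W :: "'b vec_space"
  assumes f: "linear_map class_ring V W f" and bij: "bij_betw f (carrier V) (carrier W)"
  shows "vdim V = vdim W"
proof -
  interpret f: linear_map class_ring V W f by fact
  interpret g: linear_map class_ring W V "inv_into (carrier V) f"
    using f bij by (rule linear_map_inv)
  show ?thesis
  proof (cases "vectorspace.fin_dim class_ring V")
    case True
    then show ?thesis
      using bij by (intro f.dim_eq) (auto simp: bij_betw_def)
  next
    case False
    then have "\<not> vectorspace.fin_dim class_ring W"
      using g.surj_fin_dim bij bij_betw_inv_into[OF bij] by (auto simp: bij_betw_def)
    with False show ?thesis
      unfolding f.V.dim_def f.W.dim_def f.V.fin_dim_def f.W.fin_dim_def
      by (metis (no_types, lifting))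
  qed
qed

text \<open>The induced map evaluates \<open>f\<close> at a chosen element of the coset; the value is
  independent of the choice because \<open>f\<close> vanishes on \<open>U\<close>.\<close>

lemma linear_map_factor:
  fixes V :: "'a vec_space" and W :: "'b vec_space"
  assumes f: "linear_map class_ring V W f"
    and U: "VectorSpace.subspace class_ring U V"
    and ker: "\<And>x. x \<in> U \<Longrightarrow> f x = \<zero>\<^bsub>W\<^esub>"
  shows "\<exists>g. linear_map class_ring (quotient_space V U) W g \<and> (\<forall>x\<in>carrier V. g (U +>\<^bsub>V\<^esub> x) = f x)"
proof -
  interpret f: linear_map class_ring V W f by fact
  interpret p: linear_map class_ring V "quotient_space V U" "\<lambda>x. U +>\<^bsub>V\<^esub> x"
    using U by (rule quotient_projection)
  interpret U: abelian_subgroup U V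
    using U by (rule subspace_abelian_subgroup)
  define g where "g = (\<lambda>X. f (SOME x. x \<in> X))"
  have g: "g (U +>\<^bsub>V\<^esub> x) = f x" if x: "x \<in> carrier V" for x
  proof -
    define y where "y = (SOME y. y \<in> U +>\<^bsub>V\<^esub> x)"
    have y: "y \<in> U +>\<^bsub>V\<^esub> x"
      unfolding y_def using U.a_rcos_self[OF x] by (rule someI)
    then have yc: "y \<in> carrier V" and "U +>\<^bsub>V\<^esub> y = U +>\<^bsub>V\<^esub> x"
      using x U.a_elemrcos_carrier U.a_repr_independence' by auto
    then have "y \<ominus>\<^bsub>V\<^esub> x \<in> U"
      using coset_eq_iff[OF U yc x] by simp
    then have "f y \<ominus>\<^bsub>W\<^esub> f x = \<zero>\<^bsub>W\<^esub>"
      using ker[of "y \<ominus>\<^bsub>V\<^esub> x"] x yc by simp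
    then have "f y = f x"
      using x yc by simp
    then show ?thesis
      by (simp add: g_def y_def)
  qed
  have "linear_map class_ring (quotient_space V U) W g"
  proof (rule linear_mapI)
    show "vectorspace class_ring (quotient_space V U)" "vectorspace class_ring W"
      by unfold_locales
    show "g X \<in> carrier W" if "X \<in> carrier (quotient_space V U)" for X
      using that by (auto simp: carrier_quotient_space g)
    show "g (X \<oplus>\<^bsub>quotient_space V U\<^esub> Y) = g X \<oplus>\<^bsub>W\<^esub> g Y"
      if XY: "X \<in> carrier (quotient_space V U)" "Y \<in> carrier (quotient_space V U)" for X Y
    proof -
      obtain x y where xy: "x \<in> carrier V" "X = U +>\<^bsub>V\<^esub> x" "y \<in> carrier V" "Y = U +>\<^bsub>V\<^esub> y"
        using XY unfolding carrier_quotient_space by blast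
      then show ?thesis
        using g[of "x \<oplus>\<^bsub>V\<^esub> y"] by (simp add: g)
    qed
    show "g (k \<odot>\<^bsub>quotient_space V U\<^esub> X) = k \<odot>\<^bsub>W\<^esub> g X"
      if X: "X \<in> carrier (quotient_space V U)" for k X
    proof -
      obtain x where x: "x \<in> carrier V" "X = U +>\<^bsub>V\<^esub> x"
        using X unfolding carrier_quotient_space by blast
      then show ?thesis
        using g[of "k \<odot>\<^bsub>V\<^esub> x"] x by (simp add: g)
    qed
  qed
  then show ?thesis
    using g by blast
qed

lemma coset_eq_if_image_eq:
  fixes V :: "'a vec_space" and W :: "'b vec_space"
  assumes f: "linear_map class_ring V W f"
    and ker: "U = {x \<in> carrier V. f x = \<zero>\<^bsub>W\<^esub>}"
    and xy: "x \<in> carrier V" "y \<in> carrier V" "f x = f y"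
  shows "U +>\<^bsub>V\<^esub> x = U +>\<^bsub>V\<^esub> y"
proof -
  interpret f: linear_map class_ring V W f by fact
  have "VectorSpace.subspace class_ring U V"
    using f.kerT_is_subspace ker by (simp add: f.ker_def)
  moreover have "x \<ominus>\<^bsub>V\<^esub> y \<in> U"
    using xy by (simp add: ker)
  ultimately show ?thesis
    using coset_eq_iff[of U V x y] xy(1,2) by blast
qed

text \<open>The first isomorphism theorem.\<close>

lemma vdim_quotient_of_onto:
  fixes V :: "'a vec_space" and W :: "'b vec_space"
  assumes f: "linear_map class_ring V W f"
    and onto: "f ` carrier V = carrier W"
    and ker: "U = {x \<in> carrier V. f x = \<zero>\<^bsub>W\<^esub>}"
  shows "vdim (quotient_space V U) = vdim W"
proof -
  interpret f: linear_map class_ring V W f by fact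
  have U: "VectorSpace.subspace class_ring U V"
    using f.kerT_is_subspace ker by (simp add: f.ker_def)
  have fU: "f x = \<zero>\<^bsub>W\<^esub>" if "x \<in> U" for x
    using that by (simp add: ker)
  obtain g where g: "linear_map class_ring (quotient_space V U) W g"
    and gf: "\<And>x. x \<in> carrier V \<Longrightarrow> g (U +>\<^bsub>V\<^esub> x) = f x"
    using linear_map_factor[OF f U fU] by blast
  have "bij_betw g (carrier (quotient_space V U)) (carrier W)"
  proof (rule bij_betw_imageI)
    show "g ` carrier (quotient_space V U) = carrier W"
      by (simp add: carrier_quotient_space image_image gf flip: onto cong: image_cong)
    show "inj_on g (carrier (quotient_space V U))"
    proof (rule inj_onI)
      fix X Y
      assume "X \<in> carrier (quotient_space V U)" "Y \<in> carrier (quotient_space V U)" "g X = g Y"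
      then obtain x y where xy: "x \<in> carrier V" "X = U +>\<^bsub>V\<^esub> x" "y \<in> carrier V" "Y = U +>\<^bsub>V\<^esub> y"
        "f x = f y"
        by (auto simp: carrier_quotient_space gf)
      then show "X = Y"
        using coset_eq_if_image_eq[OF f ker xy(1,3,5)] xy(2,4) by simp
    qed
  qed
  with g show ?thesis
    by (rule vdim_eq_of_bij)
qed

text \<open>The form in which the isomorphism theorem computes homology: relative chains are already
  a quotient \<open>V/Y\<close>, and homology divides them by boundaries. If \<open>f\<close> identifies
  \<open>V/Y\<close> with \<open>N\<close>, it only remains to know which subspace \<open>T\<close> of \<open>N\<close>
  the boundaries correspond to. The map \<open>V \<rightarrow> N/T\<close> factors through \<open>V/Y\<close>, and the
  kernel of the factor is \<open>U\<close>.\<close>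

lemma vdim_iterated_quotient:
  fixes V :: "'a vec_space" and N :: "'b vec_space"
  assumes f: "linear_map class_ring V N f"
    and onto: "f ` carrier V = carrier N"
    and Y: "Y = {x \<in> carrier V. f x = \<zero>\<^bsub>N\<^esub>}"
    and T: "VectorSpace.subspace class_ring T N"
    and U: "U = {Y +>\<^bsub>V\<^esub> x | x. x \<in> carrier V \<and> f x \<in> T}"
  shows "vdim (quotient_space (quotient_space V Y) U) = vdim (quotient_space N T)"
proof -
  interpret f: linear_map class_ring V N f by fact
  interpret q: linear_map class_ring N "quotient_space N T" "\<lambda>x. T +>\<^bsub>N\<^esub> x"
    using T by (rule quotient_projection)
  interpret T: abelian_subgroup T N
    using T by (rule subspace_abelian_subgroup)
  have Ys: "VectorSpace.subspace class_ring Y V"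
    using f.kerT_is_subspace Y by (simp add: f.ker_def)
  have h: "linear_map class_ring V (quotient_space N T) (\<lambda>x. T +>\<^bsub>N\<^esub> f x)"
    by (rule linear_mapI) (use q.T_smult in \<open>auto intro: f.V.vectorspace_axioms q.W.vectorspace_axioms\<close>)
  have hY: "T +>\<^bsub>N\<^esub> f x = \<zero>\<^bsub>quotient_space N T\<^esub>" if "x \<in> Y" for x
    using that q.T0_is_0 by (simp add: Y)
  obtain g where g: "linear_map class_ring (quotient_space V Y) (quotient_space N T) g"
    and gf: "\<And>x. x \<in> carrier V \<Longrightarrow> g (Y +>\<^bsub>V\<^esub> x) = T +>\<^bsub>N\<^esub> f x"
    using linear_map_factor[OF h Ys hY] by blast
  have minus0: "z \<ominus>\<^bsub>N\<^esub> \<zero>\<^bsub>N\<^esub> = z" if "z \<in> carrier N" for z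
    using that by (simp add: a_minus_def)
  have T0: "T +>\<^bsub>N\<^esub> z = \<zero>\<^bsub>quotient_space N T\<^esub> \<longleftrightarrow> z \<in> T" if "z \<in> carrier N" for z
    using coset_eq_iff[OF T that, of "\<zero>\<^bsub>N\<^esub>"] q.T0_is_0 minus0[OF that] that by simp
  show ?thesis
  proof (rule vdim_quotient_of_onto[OF g])
    have "g ` carrier (quotient_space V Y) = (\<lambda>x. g (Y +>\<^bsub>V\<^esub> x)) ` carrier V"
      by (simp add: carrier_quotient_space image_image)
    also have "\<dots> = (\<lambda>x. T +>\<^bsub>N\<^esub> f x) ` carrier V"
      using gf by (rule image_cong[OF refl])
    also have "\<dots> = carrier (quotient_space N T)"
      unfolding carrier_quotient_space onto[symmetric] image_image ..
    finally show "g ` carrier (quotient_space V Y) = carrier (quotient_space N T)" .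
    have "g (Y +>\<^bsub>V\<^esub> x) = \<zero>\<^bsub>quotient_space N T\<^esub> \<longleftrightarrow> f x \<in> T" if "x \<in> carrier V" for x
      using gf[OF that] T0[of "f x"] that by simp
    then show "U = {X \<in> carrier (quotient_space V Y). g X = \<zero>\<^bsub>quotient_space N T\<^esub>}"
      unfolding U carrier_quotient_space by blast
  qed
qed

section \<open>Chains with coefficients in a cosheaf\<close>

lemma family_sum_simps [simp]:
  "carrier (family_sum S A) = (\<Pi>\<^sub>E i\<in>S. carrier (A i))"
  "\<zero>\<^bsub>family_sum S A\<^esub> = (\<lambda>i\<in>S. \<zero>\<^bsub>A i\<^esub>)"
  "f \<oplus>\<^bsub>family_sum S A\<^esub> g = (\<lambda>i\<in>S. f i \<oplus>\<^bsub>A i\<^esub> g i)"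
  "k \<odot>\<^bsub>family_sum S A\<^esub> f = (\<lambda>i\<in>S. k \<odot>\<^bsub>A i\<^esub> f i)"
  by (simp_all add: family_sum_def)

lemma vectorspace_family_sum:
  fixes A :: "'i \<Rightarrow> 'a vec_space"
  assumes "\<And>i. i \<in> S \<Longrightarrow> vectorspace class_ring (A i)"
  shows "vectorspace class_ring (family_sum S A)"
proof -
  note A = vectorspaceD[OF assms]
  have mem: "x i \<in> carrier (A i)" if "x \<in> carrier (family_sum S A)" "i \<in> S" for x i
    using that by (simp add: PiE_iff)
  have arb: "x i = undefined" if "x \<in> carrier (family_sum S A)" "i \<notin> S" for x i
    using that unfolding family_sum_simps by (rule PiE_arb)
  show ?thesis
  proof (rule vectorspaceI)
    fix x y z and k l :: real
    assume x: "x \<in> carrier (family_sum S A)" and y: "y \<in> carrier (family_sum S A)"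
      and z: "z \<in> carrier (family_sum S A)"
    note mem = mem[OF x] mem[OF y] mem[OF z]
    show "x \<oplus>\<^bsub>family_sum S A\<^esub> y \<in> carrier (family_sum S A)"
      by (simp add: mem A(1))
    show "(x \<oplus>\<^bsub>family_sum S A\<^esub> y) \<oplus>\<^bsub>family_sum S A\<^esub> z
        = x \<oplus>\<^bsub>family_sum S A\<^esub> (y \<oplus>\<^bsub>family_sum S A\<^esub> z)"
      by (rule ext) (simp add: restrict_def mem A(3))
    show "x \<oplus>\<^bsub>family_sum S A\<^esub> y = y \<oplus>\<^bsub>family_sum S A\<^esub> x"
      by (rule ext) (simp add: restrict_def, intro impI A(4) mem)
    show "\<zero>\<^bsub>family_sum S A\<^esub> \<oplus>\<^bsub>family_sum S A\<^esub> x = x"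
      by (rule ext) (simp add: restrict_def mem arb[OF x] A(5))
    show "(- 1) \<odot>\<^bsub>family_sum S A\<^esub> x \<oplus>\<^bsub>family_sum S A\<^esub> x = \<zero>\<^bsub>family_sum S A\<^esub>"
      by (rule ext) (simp add: restrict_def mem A(6))
    show "k \<odot>\<^bsub>family_sum S A\<^esub> x \<in> carrier (family_sum S A)"
      by (simp add: mem A(7))
    show "(k + l) \<odot>\<^bsub>family_sum S A\<^esub> x
        = k \<odot>\<^bsub>family_sum S A\<^esub> x \<oplus>\<^bsub>family_sum S A\<^esub> l \<odot>\<^bsub>family_sum S A\<^esub> x"
      by (rule ext) (simp add: restrict_def mem A(8))
    show "k \<odot>\<^bsub>family_sum S A\<^esub> (x \<oplus>\<^bsub>family_sum S A\<^esub> y)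
        = k \<odot>\<^bsub>family_sum S A\<^esub> x \<oplus>\<^bsub>family_sum S A\<^esub> k \<odot>\<^bsub>family_sum S A\<^esub> y"
      by (rule ext) (simp add: restrict_def mem A(9))
    show "(k * l) \<odot>\<^bsub>family_sum S A\<^esub> x = k \<odot>\<^bsub>family_sum S A\<^esub> (l \<odot>\<^bsub>family_sum S A\<^esub> x)"
      by (rule ext) (simp add: restrict_def mem A(10))
    show "1 \<odot>\<^bsub>family_sum S A\<^esub> x = x"
      by (rule ext) (simp add: restrict_def mem arb[OF x] A(11))
  next
    show "\<zero>\<^bsub>family_sum S A\<^esub> \<in> carrier (family_sum S A)"
      using A(2) by simp
  qed
qed

lemma chain_space_simps [simp]:
  "carrier (chain_space K A s) = (\<Pi>\<^sub>E \<sigma>\<in>simplices K s. carrier (A \<sigma>))"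
  "\<zero>\<^bsub>chain_space K A s\<^esub> = (\<lambda>\<sigma>\<in>simplices K s. \<zero>\<^bsub>A \<sigma>\<^esub>)"
  "c \<oplus>\<^bsub>chain_space K A s\<^esub> c' = (\<lambda>\<sigma>\<in>simplices K s. c \<sigma> \<oplus>\<^bsub>A \<sigma>\<^esub> c' \<sigma>)"
  "k \<odot>\<^bsub>chain_space K A s\<^esub> c = (\<lambda>\<sigma>\<in>simplices K s. k \<odot>\<^bsub>A \<sigma>\<^esub> c \<sigma>)"
  by (simp_all add: chain_space_def)

lemma vectorspace_chain_space:
  assumes "\<And>\<sigma>. \<sigma> \<in> K \<Longrightarrow> vectorspace class_ring (A \<sigma>)"
  shows "vectorspace class_ring (chain_space K A s)"
  unfolding chain_space_def using assms by (intro vectorspace_family_sum) (auto simp: simplices_def)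

lemma subspace_chains_of:
  assumes "\<And>\<sigma>. \<sigma> \<in> K \<Longrightarrow> vectorspace class_ring (A \<sigma>)"
  shows "VectorSpace.subspace class_ring (chains_of K A L s) (chain_space K A s)"
proof -
  note A = vectorspaceD[OF assms]
  have s: "\<sigma> \<in> K" if "\<sigma> \<in> simplices K s" for \<sigma>
    using that by (simp add: simplices_def)
  show ?thesis
  proof (rule subspaceI[OF vectorspace_chain_space[OF assms]])
    show "chains_of K A L s \<subseteq> carrier (chain_space K A s)"
      by (auto simp: chains_of_def)
    show "\<zero>\<^bsub>chain_space K A s\<^esub> \<in> chains_of K A L s"
      using A(2) s by (simp add: chains_of_def)
    show "c \<oplus>\<^bsub>chain_space K A s\<^esub> c' \<in> chains_of K A L s"
      if "c \<in> chains_of K A L s" "c' \<in> chains_of K A L s" for c c'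
      using that A(1,2,5) s by (simp add: chains_of_def PiE_iff)
    show "k \<odot>\<^bsub>chain_space K A s\<^esub> c \<in> chains_of K A L s" if "c \<in> chains_of K A L s" for k c
      using that A(7,12) s by (simp add: chains_of_def PiE_iff)
  qed
qed

lemma chains_of_mono: "L \<subseteq> L' \<Longrightarrow> chains_of K A L s \<subseteq> chains_of K A L' s"
  by (auto simp: chains_of_def)

lemma linear_map_boundary:
  assumes A: "\<And>\<sigma>. \<sigma> \<in> K \<Longrightarrow> vectorspace class_ring (A \<sigma>)"
    and e: "\<And>\<tau> \<sigma>. \<tau> \<in> K \<Longrightarrow> \<sigma> \<in> K \<Longrightarrow> \<sigma> \<subset> \<tau> \<Longrightarrow> linear_map class_ring (A \<tau>) (A \<sigma>) (e \<tau> \<sigma>)"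
  shows "linear_map class_ring (chain_space K A s) (chain_space K A (s - 1)) (boundary K \<omega> A e s)"
proof -
  have in_K: "\<sigma> \<in> K" if "\<sigma> \<in> simplices K t" for \<sigma> t
    using that by (simp add: simplices_def)
  let ?S = "\<lambda>\<sigma>. {\<tau> \<in> simplices K s. \<sigma> \<subset> \<tau>}"
  let ?t = "\<lambda>c \<sigma> \<tau>. incidence \<omega> \<tau> \<sigma> \<odot>\<^bsub>A \<sigma>\<^esub> e \<tau> \<sigma> (c \<tau>)"
  have tm: "?t c \<sigma> \<in> ?S \<sigma> \<rightarrow> carrier (A \<sigma>)"
    if c: "c \<in> carrier (chain_space K A s)" and \<sigma>: "\<sigma> \<in> simplices K (s - 1)" for c \<sigma>
  proof
    fix \<tau> assume \<tau>: "\<tau> \<in> ?S \<sigma>"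
    then interpret e: linear_map class_ring "A \<tau>" "A \<sigma>" "e \<tau> \<sigma>"
      using \<sigma> in_K by (intro e) auto
    show "?t c \<sigma> \<tau> \<in> carrier (A \<sigma>)"
      using PiE_mem[OF c[unfolded chain_space_simps], of \<tau>] \<tau> by simp
  qed
  show ?thesis
  proof (rule linear_mapI)
    show "vectorspace class_ring (chain_space K A s)" "vectorspace class_ring (chain_space K A (s - 1))"
      using A by (auto intro: vectorspace_chain_space)
    fix c assume c: "c \<in> carrier (chain_space K A s)"
    show "boundary K \<omega> A e s c \<in> carrier (chain_space K A (s - 1))"
    proof -
      have "finsum (A \<sigma>) (?t c \<sigma>) (?S \<sigma>) \<in> carrier (A \<sigma>)" if \<sigma>: "\<sigma> \<in> simplices K (s - 1)" for \<sigma>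
      proof -
        interpret vectorspace class_ring "A \<sigma>" using A in_K \<sigma> by blast
        show ?thesis using tm[OF c \<sigma>] by (rule M.finsum_closed)
      qed
      then show ?thesis by (simp add: boundary_def)
    qed
    show "boundary K \<omega> A e s (k \<odot>\<^bsub>chain_space K A s\<^esub> c)
        = k \<odot>\<^bsub>chain_space K A (s - 1)\<^esub> boundary K \<omega> A e s c" for k
    proof -
      have "finsum (A \<sigma>) (?t (k \<odot>\<^bsub>chain_space K A s\<^esub> c) \<sigma>) (?S \<sigma>)
          = k \<odot>\<^bsub>A \<sigma>\<^esub> finsum (A \<sigma>) (?t c \<sigma>) (?S \<sigma>)" if \<sigma>: "\<sigma> \<in> simplices K (s - 1)" for \<sigma>
      proof -
        interpret vectorspace class_ring "A \<sigma>" using A in_K \<sigma> by blast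
        note A\<sigma> = vectorspaceD[OF vectorspace_axioms]
        have "k \<odot>\<^bsub>A \<sigma>\<^esub> finsum (A \<sigma>) (?t c \<sigma>) (?S \<sigma>) = finsum (A \<sigma>) (\<lambda>\<tau>. k \<odot>\<^bsub>A \<sigma>\<^esub> ?t c \<sigma> \<tau>) (?S \<sigma>)"
          using tm[OF c \<sigma>] by (intro finsum_smult) auto
        also have "\<dots> = finsum (A \<sigma>) (?t (k \<odot>\<^bsub>chain_space K A s\<^esub> c) \<sigma>) (?S \<sigma>)"
        proof (rule M.finsum_cong'[OF refl])
          show "?t (k \<odot>\<^bsub>chain_space K A s\<^esub> c) \<sigma> \<in> ?S \<sigma> \<rightarrow> carrier (A \<sigma>)"
            using vectorspaceD(7)[OF vectorspace_chain_space[OF A] c] \<sigma> by (intro tm)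
          fix \<tau> assume \<tau>: "\<tau> \<in> ?S \<sigma>"
          then interpret e: linear_map class_ring "A \<tau>" "A \<sigma>" "e \<tau> \<sigma>"
            using \<sigma> in_K by (intro e) auto
          have "c \<tau> \<in> carrier (A \<tau>)"
            using c \<tau> by (simp add: PiE_iff)
          then have "e \<tau> \<sigma> (k \<odot>\<^bsub>A \<tau>\<^esub> c \<tau>) = k \<odot>\<^bsub>A \<sigma>\<^esub> e \<tau> \<sigma> (c \<tau>)" "e \<tau> \<sigma> (c \<tau>) \<in> carrier (A \<sigma>)"
            by simp_all
          then show "k \<odot>\<^bsub>A \<sigma>\<^esub> ?t c \<sigma> \<tau> = ?t (k \<odot>\<^bsub>chain_space K A s\<^esub> c) \<sigma> \<tau>"
            using \<tau> by (simp add: mult.commute flip: A\<sigma>(10))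
        qed
        finally show ?thesis ..
      qed
      then show ?thesis by (simp add: boundary_def fun_eq_iff restrict_def)
    qed
    fix c' assume c': "c' \<in> carrier (chain_space K A s)"
    show "boundary K \<omega> A e s (c \<oplus>\<^bsub>chain_space K A s\<^esub> c')
        = boundary K \<omega> A e s c \<oplus>\<^bsub>chain_space K A (s - 1)\<^esub> boundary K \<omega> A e s c'"
    proof -
      have "finsum (A \<sigma>) (?t (c \<oplus>\<^bsub>chain_space K A s\<^esub> c') \<sigma>) (?S \<sigma>)
          = finsum (A \<sigma>) (?t c \<sigma>) (?S \<sigma>) \<oplus>\<^bsub>A \<sigma>\<^esub> finsum (A \<sigma>) (?t c' \<sigma>) (?S \<sigma>)"
        if \<sigma>: "\<sigma> \<in> simplices K (s - 1)" for \<sigma>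
      proof -
        interpret vectorspace class_ring "A \<sigma>" using A in_K \<sigma> by blast
        note A\<sigma> = vectorspaceD[OF vectorspace_axioms]
        have "finsum (A \<sigma>) (?t c \<sigma>) (?S \<sigma>) \<oplus>\<^bsub>A \<sigma>\<^esub> finsum (A \<sigma>) (?t c' \<sigma>) (?S \<sigma>)
            = finsum (A \<sigma>) (\<lambda>\<tau>. ?t c \<sigma> \<tau> \<oplus>\<^bsub>A \<sigma>\<^esub> ?t c' \<sigma> \<tau>) (?S \<sigma>)"
          using tm[OF c \<sigma>] tm[OF c' \<sigma>] by (intro M.finsum_addf[symmetric])
        also have "\<dots> = finsum (A \<sigma>) (?t (c \<oplus>\<^bsub>chain_space K A s\<^esub> c') \<sigma>) (?S \<sigma>)"
        proof (rule M.finsum_cong'[OF refl])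
          show "?t (c \<oplus>\<^bsub>chain_space K A s\<^esub> c') \<sigma> \<in> ?S \<sigma> \<rightarrow> carrier (A \<sigma>)"
            using vectorspaceD(1)[OF vectorspace_chain_space[OF A] c c'] \<sigma> by (intro tm)
          fix \<tau> assume \<tau>: "\<tau> \<in> ?S \<sigma>"
          then interpret e: linear_map class_ring "A \<tau>" "A \<sigma>" "e \<tau> \<sigma>"
            using \<sigma> in_K by (intro e) auto
          have "c \<tau> \<in> carrier (A \<tau>)" "c' \<tau> \<in> carrier (A \<tau>)"
            using c c' \<tau> by (simp_all add: PiE_iff)
          then have "e \<tau> \<sigma> (c \<tau> \<oplus>\<^bsub>A \<tau>\<^esub> c' \<tau>) = e \<tau> \<sigma> (c \<tau>) \<oplus>\<^bsub>A \<sigma>\<^esub> e \<tau> \<sigma> (c' \<tau>)"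
            "e \<tau> \<sigma> (c \<tau>) \<in> carrier (A \<sigma>)" "e \<tau> \<sigma> (c' \<tau>) \<in> carrier (A \<sigma>)"
            by simp_all
          then show "?t c \<sigma> \<tau> \<oplus>\<^bsub>A \<sigma>\<^esub> ?t c' \<sigma> \<tau> = ?t (c \<oplus>\<^bsub>chain_space K A s\<^esub> c') \<sigma> \<tau>"
            using \<tau> by (simp add: A\<sigma>(9))
        qed
        finally show ?thesis ..
      qed
      then show ?thesis by (simp add: boundary_def fun_eq_iff restrict_def)
    qed
  qed
qed

section \<open>Vertices and edges of the order complex\<close>

text \<open>Signs can be divided out, so that every element of \<open>N a\<close> contributes its exact image to
  some boundary.\<close>

lemma incidence_nonzero: "incidence \<omega> \<tau> \<sigma> \<noteq> 0"
  by (simp add: incidence_def sign_def)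

lemma simplices_order_complex_minus_one: "simplices (order_complex R) (- 1) = {}"
  by (auto simp: simplices_def order_complex_def)

lemma simplices_order_complex_0: "simplices (order_complex R) 0 = (\<lambda>a. {a}) ` R"
  by (auto simp: simplices_def order_complex_def card_1_singleton_iff chain_def)

lemma simplices_order_complex_1:
  "simplices (order_complex R) 1 = {{a, b} | a b. a \<in> R \<and> b \<in> R \<and> a < b}"
proof (intro equalityI subsetI)
  fix \<tau> assume "\<tau> \<in> simplices (order_complex R) 1"
  then have \<tau>: "\<tau> \<subseteq> R" "Complete_Partial_Order.chain (\<le>) \<tau>" "card \<tau> = 2"
    by (auto simp: simplices_def order_complex_def)
  then obtain a b where ab: "\<tau> = {a, b}" "a \<noteq> b"
    by (auto simp: card_2_iff)
  with \<tau> have "a \<in> R" "b \<in> R" "a < b \<or> b < a"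
    by (auto simp: chain_def)
  with ab show "\<tau> \<in> {{a, b} | a b. a \<in> R \<and> b \<in> R \<and> a < b}"
    by blast
next
  fix \<tau> assume "\<tau> \<in> {{a, b} | a b. a \<in> R \<and> b \<in> R \<and> a < b}"
  then show "\<tau> \<in> simplices (order_complex R) 1"
    by (auto simp: simplices_def order_complex_def chain_def)
qed

lemma Greatest_pair: "(a::'a::order) < b \<Longrightarrow> (GREATEST x. x \<in> {a, b}) = b"
  by (rule Greatest_equality) auto

lemma Least_pair: "(a::'a::order) < b \<Longrightarrow> (LEAST x. x \<in> {a, b}) = a"
  by (rule Least_equality) auto

lemma Greatest_singleton: "(GREATEST x. x \<in> {a::'a::order}) = a"
  by (rule Greatest_equality) auto

lemma Least_singleton: "(LEAST x. x \<in> {a::'a::order}) = a"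
  by (rule Least_equality) auto

section \<open>Moebius homology in degree zero\<close>

text \<open>Relative \<open>0\<close>-chains at \<open>r\<close> are chains on the vertices \<open>{a}\<close> with
  \<open>a \<le> r\<close>, modulo those with \<open>a < r\<close>. A class is therefore determined by its
  coefficient at \<open>{r}\<close>, which may be any element of \<open>N r\<close>. Every chain is a cycle, since
  there are no simplices of dimension \<open>-1\<close>. An edge of \<open>\<Delta>R\<^bsub>\<le>r\<^esub>\<close> that has \<open>r\<close>
  as a vertex has the form \<open>{a, r}\<close> with \<open>a < r\<close> and carries an element of \<open>N a\<close>; up to sign
  its boundary has the image of this element under \<open>\<phi> a r\<close> as coefficient at \<open>{r}\<close>. The
  boundaries thus correspond to the sum of the images of the maps into \<open>N r\<close> from below.\<close>

theorem vdim_moebius_homology_0: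
  fixes R :: "'r::order set" and N :: "'r \<Rightarrow> 'a vec_space"
  assumes R: "finite R" and r: "r \<in> R"
    and N: "\<And>a. a \<in> R \<Longrightarrow> vectorspace class_ring (N a)"
    and \<phi>: "\<And>a b. a \<in> R \<Longrightarrow> b \<in> R \<Longrightarrow> a \<le> b \<Longrightarrow> linear_map class_ring (N a) (N b) (\<phi> a b)"
  shows "vdim (moebius_homology R \<omega> N \<phi> 0 r)
    = vdim (quotient_space (N r)
        (subspace_family_sum (N r) {a \<in> R. a < r} (\<lambda>a. \<phi> a r ` carrier (N a))))"
proof -
  define K where "K = order_complex R"
  define A where "A = order_cosheaf N"
  define e where "e = order_cosheaf_map \<phi>"
  define X where "X = {\<sigma> \<in> K. (GREATEST x. x \<in> \<sigma>) \<le> r}"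
  define Y where "Y = {\<sigma> \<in> K. (GREATEST x. x \<in> \<sigma>) < r}"
  define I where "I = {a \<in> R. a < r}"
  define T where "T = subspace_family_sum (N r) I (\<lambda>a. \<phi> a r ` carrier (N a))"
  define V where "V = (\<lambda>s. (chain_space K A s)\<lparr>carrier := chains_of K A X s\<rparr>)"
  let ?bd = "boundary K \<omega> A e 1"

  have K0: "simplices K 0 = (\<lambda>a. {a}) ` R"
    unfolding K_def by (rule simplices_order_complex_0)
  have K1: "simplices K 1 = {{a, b} | a b. a \<in> R \<and> b \<in> R \<and> a < b}"
    unfolding K_def by (rule simplices_order_complex_1)
  have vertex: "{a} \<in> K" if "a \<in> R" for a
    using that K0 by (auto simp: simplices_def)
  have edge: "{a, b} \<in> K" if "a \<in> R" "b \<in> R" "a < b" for a b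
    using that K1 by (force simp: simplices_def)
  have A0: "A {a} = N a" for a
    unfolding A_def order_cosheaf_def Least_singleton ..
  have A1: "A {a, b} = N a" if "a < b" for a b
    unfolding A_def order_cosheaf_def Least_pair[OF that] ..
  have e_min: "e {a, b} {c} = \<phi> a c" if "a < b" for a b c
    unfolding e_def order_cosheaf_map_def Least_pair[OF that] Least_singleton ..
  have X0: "{a} \<in> X \<longleftrightarrow> a \<le> r" and Y0: "{a} \<in> Y \<longleftrightarrow> a < r" if "a \<in> R" for a
    using vertex[OF that] unfolding X_def Y_def mem_Collect_eq Greatest_singleton by auto
  have X1: "{a, b} \<in> X \<longleftrightarrow> b \<le> r" if "a \<in> R" "b \<in> R" "a < b" for a b
    using edge[OF that] unfolding X_def mem_Collect_eq Greatest_pair[OF that(3)] by auto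
  have Y1: "{a, b} \<in> Y \<longleftrightarrow> b < r" if "a \<in> R" "b \<in> R" "a < b" for a b
    using edge[OF that] unfolding Y_def mem_Collect_eq Greatest_pair[OF that(3)] by auto
  have YX: "Y \<subseteq> X"
    by (auto simp: X_def Y_def)
  have IR: "a \<in> R" "a < r" if "a \<in> I" for a
    using that by (simp_all add: I_def)
  \<comment> \<open>A simplex of the order complex is a finite chain, so its minimal element is its least.\<close>
  have least: "(LEAST x. x \<in> \<sigma>) \<in> \<sigma>" "\<And>x. x \<in> \<sigma> \<Longrightarrow> (LEAST x. x \<in> \<sigma>) \<le> x" "\<sigma> \<subseteq> R"
    if "\<sigma> \<in> K" for \<sigma>
  proof -
    have \<sigma>: "finite \<sigma>" "\<sigma> \<noteq> {}" "Complete_Partial_Order.chain (\<le>) \<sigma>" "\<sigma> \<subseteq> R"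
      using that by (auto simp: K_def order_complex_def)
    then obtain m where m: "m \<in> \<sigma>" "\<forall>x\<in>\<sigma>. x \<le> m \<longrightarrow> m = x"
      using finite_has_minimal[of \<sigma>] by blast
    then have "\<forall>x\<in>\<sigma>. m \<le> x"
      using \<sigma>(3) by (metis chain_def order_refl)
    then show "(LEAST x. x \<in> \<sigma>) \<in> \<sigma>" "\<And>x. x \<in> \<sigma> \<Longrightarrow> (LEAST x. x \<in> \<sigma>) \<le> x" "\<sigma> \<subseteq> R"
      using m(1) \<sigma>(4) Least_equality[of "\<lambda>x. x \<in> \<sigma>" m] by auto
  qed
  have A: "vectorspace class_ring (A \<sigma>)" if "\<sigma> \<in> K" for \<sigma>
    using N least[OF that] by (auto simp: A_def order_cosheaf_def)
  have e: "linear_map class_ring (A \<tau>) (A \<sigma>) (e \<tau> \<sigma>)" if "\<tau> \<in> K" "\<sigma> \<in> K" "\<sigma> \<subset> \<tau>" for \<tau> \<sigma>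
    unfolding A_def e_def order_cosheaf_def order_cosheaf_map_def
    using least[OF that(1)] least[OF that(2)] that(3) by (intro \<phi>) auto
  note Nr = vectorspaceD[OF N[OF r]]
  interpret Nr: vectorspace class_ring "N r"
    using N r by blast

  have V: "vectorspace class_ring (V s)" for s
    unfolding V_def by (rule vectorspace.subspace_is_vs[OF vectorspace_chain_space[OF A] subspace_chains_of[OF A]])
  have V_simps [simp]: "carrier (V s) = chains_of K A X s"
    "c \<oplus>\<^bsub>V s\<^esub> c' = (\<lambda>\<sigma>\<in>simplices K s. c \<sigma> \<oplus>\<^bsub>A \<sigma>\<^esub> c' \<sigma>)"
    "k \<odot>\<^bsub>V s\<^esub> c = (\<lambda>\<sigma>\<in>simplices K s. k \<odot>\<^bsub>A \<sigma>\<^esub> c \<sigma>)"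
    "\<zero>\<^bsub>V s\<^esub> = (\<lambda>\<sigma>\<in>simplices K s. \<zero>\<^bsub>A \<sigma>\<^esub>)" for s c c' k
    by (simp_all add: V_def)
  have r0: "{r} \<in> simplices K 0"
    using r K0 by simp
  have ev: "linear_map class_ring (V 0) (N r) (\<lambda>c. c {r})"
  proof (rule linear_mapI)
    show "vectorspace class_ring (V 0)" "vectorspace class_ring (N r)"
      by (fact V) (rule N[OF r])
    show "c {r} \<in> carrier (N r)" if "c \<in> carrier (V 0)" for c
      using that r0 A0[of r] by (auto simp: chains_of_def PiE_iff)
  qed (use r0 A0[of r] in simp_all)
  \<comment> \<open>Evaluation at \<open>{r}\<close> identifies relative \<open>0\<close>-chains with \<open>N r\<close>.\<close>
  have onto: "(\<lambda>c. c {r}) ` carrier (V 0) = carrier (N r)"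
  proof (intro equalityI subsetI)
    fix n assume n: "n \<in> carrier (N r)"
    define c where "c = (\<lambda>\<sigma>\<in>simplices K 0. if \<sigma> = {r} then n else \<zero>\<^bsub>A \<sigma>\<^esub>)"
    have "\<zero>\<^bsub>N a\<^esub> \<in> carrier (N a)" if "a \<in> R" for a
      using vectorspaceD(2)[OF N[OF that]] .
    then have "c \<in> carrier (V 0)"
      using n A0 X0 r by (auto simp: c_def chains_of_def K0)
    moreover have "c {r} = n"
      using r0 by (simp add: c_def)
    ultimately show "n \<in> (\<lambda>c. c {r}) ` carrier (V 0)"
      by blast
  qed (use linear_map.T_im[OF ev] in blast)
  have kernel: "chains_of K A Y 0 = {c \<in> carrier (V 0). c {r} = \<zero>\<^bsub>N r\<^esub>}"
  proof (intro equalityI subsetI)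
    fix c assume c: "c \<in> chains_of K A Y 0"
    then have "c {r} = \<zero>\<^bsub>N r\<^esub>"
      using r0 Y0[OF r] A0[of r] by (simp add: chains_of_def)
    then show "c \<in> {c \<in> carrier (V 0). c {r} = \<zero>\<^bsub>N r\<^esub>}"
      using c chains_of_mono[OF YX] by auto
  next
    fix c assume c: "c \<in> {c \<in> carrier (V 0). c {r} = \<zero>\<^bsub>N r\<^esub>}"
    have "c {a} = \<zero>\<^bsub>N a\<^esub>" if "a \<in> R" "\<not> a < r" for a
    proof (cases "a = r")
      case False
      then have "{a} \<in> simplices K 0 - X"
        using that X0 K0 by (auto simp: less_le)
      then show ?thesis
        using c A0[of a] by (auto simp: chains_of_def)
    qed (use c in simp)
    then show "c \<in> chains_of K A Y 0"
      using c A0 Y0 by (auto simp: chains_of_def K0)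
  qed
  have T: "VectorSpace.subspace class_ring T (N r)"
    unfolding T_def
  proof (rule subspace_subspace_family_sum[OF N[OF r]])
    fix a assume "a \<in> I"
    then interpret linear_map class_ring "N a" "N r" "\<phi> a r"
      using IR[OF \<open>a \<in> I\<close>] r by (intro \<phi>) (auto simp: less_imp_le)
    show "VectorSpace.subspace class_ring (\<phi> a r ` carrier (N a)) (N r)"
      using imT_is_subspace by (simp add: im_def)
  qed

  have cN: "c {a, b} \<in> carrier (N a)"
    if c: "c \<in> chains_of K A X 1" and ab: "a \<in> R" "b \<in> R" "a < b" for a b c
  proof -
    have "{a, b} \<in> simplices K 1"
      using ab K1 by blast
    then have "c {a, b} \<in> carrier (A {a, b})"
      using c by (auto simp: chains_of_def PiE_iff)
    then show ?thesis
      using A1[OF \<open>a < b\<close>] by simp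
  qed
  let ?u = "\<lambda>c a. incidence \<omega> {a, r} {r} \<odot>\<^bsub>N r\<^esub> \<phi> a r (c {a, r})"
  have summand: "?u c a \<in> \<phi> a r ` carrier (N a)" "?u c a \<in> carrier (N r)"
    if c: "c \<in> chains_of K A X 1" and a: "a \<in> I" for c a
  proof -
    interpret linear_map class_ring "N a" "N r" "\<phi> a r"
      using IR[OF a] r by (intro \<phi>) (auto simp: less_imp_le)
    have ca: "c {a, r} \<in> carrier (N a)"
      using cN[OF c] IR[OF a] r by blast
    then have "?u c a = \<phi> a r (incidence \<omega> {a, r} {r} \<odot>\<^bsub>N a\<^esub> c {a, r})"
      by simp
    then show "?u c a \<in> \<phi> a r ` carrier (N a)"
      using vectorspaceD(7)[OF V.vectorspace_axioms ca] by blast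
    then show "?u c a \<in> carrier (N r)"
      by auto
  qed
  \<comment> \<open>An edge containing \<open>r\<close> is \<open>{a, r}\<close> with \<open>a < r\<close>, or \<open>{r, b}\<close> with \<open>r < b\<close>.
      Edges of the second kind are not in \<open>X\<close>, so chains of \<open>X\<close> vanish on them.\<close>
  have bd_r: "?bd c {r} = finsum (N r) (?u c) I" if c: "c \<in> chains_of K A X 1" for c
  proof -
    let ?t = "\<lambda>\<tau>. incidence \<omega> \<tau> {r} \<odot>\<^bsub>N r\<^esub> e \<tau> {r} (c \<tau>)"
    let ?S = "{\<tau> \<in> simplices K 1. {r} \<subset> \<tau>}"
    have sub: "(\<lambda>a. {a, r}) ` I \<subseteq> ?S"
      using K1 r by (auto simp: I_def)
    have up: "\<exists>b\<in>R. r < b \<and> \<tau> = {r, b}" if "\<tau> \<in> ?S - (\<lambda>a. {a, r}) ` I" for \<tau>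
      using that K1 by (auto simp: I_def)
    have zero: "?t \<tau> = \<zero>\<^bsub>N r\<^esub>" if \<tau>: "\<tau> \<in> ?S - (\<lambda>a. {a, r}) ` I" for \<tau>
    proof -
      obtain b where b: "b \<in> R" "r < b" "\<tau> = {r, b}"
        using up[OF \<tau>] by blast
      then have "\<tau> \<in> simplices K 1 - X"
        using \<tau> X1[OF r b(1,2)] by auto
      then have "c \<tau> = \<zero>\<^bsub>N r\<^esub>"
        using c b A1 by (auto simp: chains_of_def)
      moreover have "e \<tau> {r} \<zero>\<^bsub>N r\<^esub> = \<zero>\<^bsub>N r\<^esub>"
        using linear_map.T0_is_0[OF \<phi>[OF r r order_refl]] e_min[of r b r] b by simp
      ultimately show ?thesis
        using Nr(12) by simp
    qed
    have low: "?t {a, r} = ?u c a" if "a \<in> I" for a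
      using e_min IR[OF that] by simp
    have "finite (simplices K 1)"
      by (rule finite_subset[of _ "Pow R"]) (use R K1 in auto)
    then have fin: "finite ?S"
      by simp
    have t_N: "?t \<in> ?S \<rightarrow> carrier (N r)"
    proof
      fix \<tau> assume \<tau>: "\<tau> \<in> ?S"
      show "?t \<tau> \<in> carrier (N r)"
      proof (cases "\<tau> \<in> (\<lambda>a. {a, r}) ` I")
        case True
        then obtain a where "a \<in> I" "\<tau> = {a, r}"
          by blast
        then show ?thesis
          using low[of a] summand(2)[OF c, of a] by simp
      next
        case False
        then show ?thesis
          using zero[of \<tau>] \<tau> Nr(2) by simp
      qed
    qed
    have inj: "inj_on (\<lambda>a. {a, r}) I"
      by (auto simp: inj_on_def I_def doubleton_eq_iff)
    have "?bd c {r} = finsum (N r) ?t ?S"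
      using r0 A0[of r] by (simp add: boundary_def)
    also have "\<dots> = finsum (N r) ?t ((\<lambda>a. {a, r}) ` I)"
      by (rule Nr.M.add.finprod_mono_neutral_cong_right[OF fin sub zero refl t_N])
    also have "\<dots> = finsum (N r) (\<lambda>a. ?t {a, r}) I"
      using t_N sub inj by (intro Nr.M.finsum_reindex) auto
    also have "\<dots> = finsum (N r) (?u c) I"
      by (intro Nr.M.finsum_cong' low) (use summand(2)[OF c] in auto)
    finally show ?thesis .
  qed
  \<comment> \<open>\<open>X\<close> is a subcomplex: an edge with a vertex \<open>a\<close> such that \<open>\<not> a \<le> r\<close> has its
      maximum not below \<open>r\<close> either.\<close>
  have bd_X: "?bd c \<in> chains_of K A X 0" if c: "c \<in> chains_of K A X 1" for c
  proof -
    have lin: "linear_map class_ring (chain_space K A 1) (chain_space K A 0) ?bd"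
      using linear_map_boundary[OF A e, where s = 1] by simp
    have "?bd c \<in> carrier (chain_space K A 0)"
      using c linear_map.T_im[OF lin, of c] by (simp add: chains_of_def)
    moreover have "?bd c \<sigma> = \<zero>\<^bsub>A \<sigma>\<^esub>" if \<sigma>: "\<sigma> \<in> simplices K 0 - X" for \<sigma>
    proof -
      obtain a where a: "a \<in> R" "\<sigma> = {a}" "\<not> a \<le> r"
        using \<sigma> K0 X0 by auto
      have \<sigma>K: "\<sigma> \<in> K"
        using \<sigma> by (simp add: simplices_def)
      have "incidence \<omega> \<tau> \<sigma> \<odot>\<^bsub>A \<sigma>\<^esub> e \<tau> \<sigma> (c \<tau>) = \<zero>\<^bsub>A \<sigma>\<^esub>"
        if \<tau>: "\<tau> \<in> simplices K 1" "\<sigma> \<subset> \<tau>" for \<tau>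
      proof -
        obtain x y where xy: "x \<in> R" "y \<in> R" "x < y" "\<tau> = {x, y}"
          using \<tau>(1) unfolding K1 by blast
        have "a \<in> {x, y}"
          using psubset_imp_subset[OF \<tau>(2)] unfolding a(2) xy(4) by simp
        then have "a \<le> y"
          using xy(3) by auto
        then have "\<not> y \<le> r"
          using a(3) order_trans by blast
        then have "\<tau> \<in> simplices K 1 - X"
          using X1[OF xy(1-3)] xy(4) \<tau>(1) by simp
        then have "c \<tau> = \<zero>\<^bsub>A \<tau>\<^esub>"
          using c unfolding chains_of_def by blast
        moreover have "\<tau> \<in> K"
          using \<tau>(1) by (simp add: simplices_def)
        ultimately have "e \<tau> \<sigma> (c \<tau>) = \<zero>\<^bsub>A \<sigma>\<^esub>"
          using linear_map.T0_is_0[OF e[OF _ \<sigma>K \<tau>(2)]] by simp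
        then show ?thesis
          using vectorspaceD(12)[OF A[OF \<sigma>K]] by simp
      qed
      then have "finsum (A \<sigma>) (\<lambda>\<tau>. incidence \<omega> \<tau> \<sigma> \<odot>\<^bsub>A \<sigma>\<^esub> e \<tau> \<sigma> (c \<tau>))
          {\<tau> \<in> simplices K 1. \<sigma> \<subset> \<tau>} = \<zero>\<^bsub>A \<sigma>\<^esub>"
        by (intro finsum_eq_zero[OF A[OF \<sigma>K]]) simp
      then show ?thesis
        using \<sigma> by (simp add: boundary_def)
    qed
    ultimately show ?thesis
      by (simp add: chains_of_def)
  qed
  have bd_T: "?bd c {r} \<in> T" if c: "c \<in> chains_of K A X 1" for c
    unfolding T_def subspace_family_sum_def bd_r[OF c] using summand(1)[OF c] by blast
  have T_bd: "\<exists>c\<in>chains_of K A X 1. ?bd c {r} = n" if n: "n \<in> T" for n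
  proof -
    obtain x where x: "n = finsum (N r) x I" "\<forall>a\<in>I. x a \<in> \<phi> a r ` carrier (N a)"
      using n unfolding T_def subspace_family_sum_def by blast
    then have "\<forall>a\<in>I. \<exists>y. y \<in> carrier (N a) \<and> x a = \<phi> a r y"
      by blast
    then obtain y where y: "\<forall>a\<in>I. y a \<in> carrier (N a) \<and> x a = \<phi> a r (y a)"
      by (rule bchoice[THEN exE])
    \<comment> \<open>Dividing by the sign makes the contribution of \<open>{a, r}\<close> to the boundary equal to
        \<open>x a\<close>.\<close>
    define c where "c = (\<lambda>\<tau>\<in>simplices K 1. if \<exists>a\<in>I. \<tau> = {a, r}
      then inverse (incidence \<omega> \<tau> {r}) \<odot>\<^bsub>A \<tau>\<^esub> y (LEAST a. a \<in> \<tau>) else \<zero>\<^bsub>A \<tau>\<^esub>)"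
    have c_a: "c {a, r} = inverse (incidence \<omega> {a, r} {r}) \<odot>\<^bsub>N a\<^esub> y a" if "a \<in> I" for a
    proof -
      have "{a, r} \<in> simplices K 1"
        using IR[OF that] r K1 by blast
      then show ?thesis
        using that Least_pair[OF IR(2)[OF that]] A1[OF IR(2)[OF that]] unfolding c_def by auto
    qed
    have c_X: "c \<in> chains_of K A X 1"
    proof -
      have "c \<tau> \<in> carrier (A \<tau>)" "\<tau> \<notin> X \<Longrightarrow> c \<tau> = \<zero>\<^bsub>A \<tau>\<^esub>" if \<tau>: "\<tau> \<in> simplices K 1" for \<tau>
      proof (atomize (full), cases "\<exists>a\<in>I. \<tau> = {a, r}")
        case True
        then obtain a where a: "a \<in> I" "\<tau> = {a, r}"
          by blast
        then have "\<tau> \<in> X"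
          using X1[of a r] IR[OF a(1)] r by simp
        moreover have "c \<tau> \<in> carrier (A \<tau>)"
          using c_a[OF a(1)] a y A1[OF IR(2)[OF a(1)]] vectorspaceD(7)[OF N[OF IR(1)[OF a(1)]]] by simp
        ultimately show "c \<tau> \<in> carrier (A \<tau>) \<and> (\<tau> \<notin> X \<longrightarrow> c \<tau> = \<zero>\<^bsub>A \<tau>\<^esub>)"
          by simp
      next
        case False
        then have "c \<tau> = \<zero>\<^bsub>A \<tau>\<^esub>"
          using \<tau> by (simp add: c_def)
        then show "c \<tau> \<in> carrier (A \<tau>) \<and> (\<tau> \<notin> X \<longrightarrow> c \<tau> = \<zero>\<^bsub>A \<tau>\<^esub>)"
          using vectorspaceD(2)[OF A[of \<tau>]] \<tau> by (simp add: simplices_def)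
      qed
      moreover have "c \<in> extensional (simplices K 1)"
        by (simp add: c_def)
      ultimately show ?thesis
        by (auto simp: chains_of_def PiE_iff)
    qed
    have "?u c a = x a" if a: "a \<in> I" for a
    proof -
      interpret linear_map class_ring "N a" "N r" "\<phi> a r"
        using IR[OF a] r by (intro \<phi>) (auto simp: less_imp_le)
      have ya: "y a \<in> carrier (N a)" "x a = \<phi> a r (y a)"
        using y a by auto
      then have "?u c a = (incidence \<omega> {a, r} {r} * inverse (incidence \<omega> {a, r} {r})) \<odot>\<^bsub>N r\<^esub> x a"
        using c_a[OF a] Nr(10)[of "x a"] by simp
      then show ?thesis
        using ya Nr(11) incidence_nonzero[of \<omega> "{a, r}" "{r}"] by simp
    qed
    then have "finsum (N r) (?u c) I = finsum (N r) x I"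
      using summand(2)[OF c_X] by (intro Nr.M.finsum_cong') force+
    then have "?bd c {r} = n"
      using bd_r[OF c_X] x(1) by simp
    with c_X show ?thesis
      by blast
  qed

  let ?Q = "\<lambda>s. relative_chain_space K A X Y s" and ?D = "relative_boundary K \<omega> A e X Y"
  have Y_sub: "VectorSpace.subspace class_ring (chains_of K A Y 0) (V 0)"
    using linear_map.kerT_is_subspace[OF ev] kernel
    by (simp add: mod_hom.ker_def[OF linear_map.axioms(3)[OF ev]])
  have Q: "?Q s = quotient_space (V s) (chains_of K A Y s)" for s
    by (simp add: relative_chain_space_def V_def)
  have coset_cong: "chains_of K A Y 0 +>\<^bsub>V 0\<^esub> u = chains_of K A Y 0 +>\<^bsub>V 0\<^esub> v"
    if u: "u \<in> chains_of K A X 0" and v: "v \<in> chains_of K A X 0" and uv: "u {r} = v {r}" for u v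
    using u v uv by (intro coset_eq_if_image_eq[OF ev kernel]) simp_all
  \<comment> \<open>In degree \<open>-1\<close> there are no simplices, so the only chain is the empty function.\<close>
  have D0: "?D 0 x = \<zero>\<^bsub>?Q (0 - 1)\<^esub>" if x: "x \<in> carrier (?Q 0)" for x
  proof -
    interpret Y: abelian_subgroup "chains_of K A Y 0" "V 0"
      using Y_sub by (rule subspace_abelian_subgroup)
    obtain u where u: "u \<in> carrier (V 0)" "x = chains_of K A Y 0 +>\<^bsub>V 0\<^esub> u"
      using x unfolding Q carrier_quotient_space by blast
    then have "x \<noteq> {}"
      using Y.a_rcos_self by blast
    moreover have "simplices K (- 1) = {}"
      unfolding K_def by (rule simplices_order_complex_minus_one)
    ultimately show ?thesis
      by (simp add: relative_boundary_def quotient_map_def relative_chain_space_def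
          quotient_space_def chains_of_def boundary_def a_r_coset_def')
  qed
  \<comment> \<open>The chains of \<open>Y\<close> vanish on all edges \<open>{a, r}\<close>, so they do not change the
      coefficient of a boundary at \<open>{r}\<close>.\<close>
  have D1: "?D 1 (chains_of K A Y 1 +>\<^bsub>V 1\<^esub> c) = chains_of K A Y 0 +>\<^bsub>V 0\<^esub> ?bd c"
    if c: "c \<in> chains_of K A X 1" for c
  proof -
    let ?C = "chains_of K A Y 1 +>\<^bsub>V 1\<^esub> c"
    note V1 = vectorspaceD[OF V[of 1]]
    have "\<zero>\<^bsub>V 1\<^esub> \<in> chains_of K A Y 1"
      using subspace_chains_of[OF A, where L = Y and s = 1]
      by (simp add: VectorSpace.subspace_def LinearCombinations.submodule_def)
    then have "\<zero>\<^bsub>V 1\<^esub> \<oplus>\<^bsub>V 1\<^esub> c \<in> ?C"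
      unfolding a_r_coset_def' by blast
    then have "?C \<noteq> {}"
      by blast
    have "chains_of K A Y 0 +>\<^bsub>V 0\<^esub> ?bd c' = chains_of K A Y 0 +>\<^bsub>V 0\<^esub> ?bd c" if c': "c' \<in> ?C" for c'
    proof -
      obtain h where h: "h \<in> chains_of K A Y 1" "c' = h \<oplus>\<^bsub>V 1\<^esub> c"
        using c' unfolding a_r_coset_def' by blast
      then have c'X: "c' \<in> chains_of K A X 1"
        using V1(1)[of h c] chains_of_mono[OF YX, where K = K and A = A and s = 1] c by auto
      have "?u c' a = ?u c a" if a: "a \<in> I" for a
      proof -
        have ar: "{a, r} \<in> simplices K 1" "a \<in> R" "a < r"
          using IR[OF a] r K1 by auto
        then have "h {a, r} = \<zero>\<^bsub>N a\<^esub>"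
          using h(1) Y1[of a r] A1[of a r] r by (simp add: chains_of_def)
        then have "c' {a, r} = c {a, r}"
          using h(2) ar A1[of a r] cN[OF c, of a r] r vectorspaceD(5)[OF N[of a]] by simp
        then show ?thesis
          by simp
      qed
      then have "finsum (N r) (?u c') I = finsum (N r) (?u c) I"
        using summand(2)[OF c] by (intro Nr.M.finsum_cong') auto
      then show ?thesis
        using bd_r[OF c] bd_r[OF c'X] by (intro coset_cong bd_X c c'X) simp
    qed
    then have "(\<Union>c'\<in>?C. chains_of K A Y 0 +>\<^bsub>V 0\<^esub> ?bd c') = (\<Union>c'\<in>?C. chains_of K A Y 0 +>\<^bsub>V 0\<^esub> ?bd c)"
      by (rule SUP_cong[OF refl])
    also have "\<dots> = chains_of K A Y 0 +>\<^bsub>V 0\<^esub> ?bd c"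
      using \<open>?C \<noteq> {}\<close> by simp
    finally show ?thesis
      by (simp add: relative_boundary_def quotient_map_def V_def)
  qed
  have img: "?D 1 ` carrier (?Q 1)
      = {chains_of K A Y 0 +>\<^bsub>V 0\<^esub> u | u. u \<in> carrier (V 0) \<and> u {r} \<in> T}" (is "_ = ?U")
  proof (intro equalityI subsetI)
    fix x assume "x \<in> ?D 1 ` carrier (?Q 1)"
    then obtain c where "c \<in> chains_of K A X 1" "x = chains_of K A Y 0 +>\<^bsub>V 0\<^esub> ?bd c"
      using D1 unfolding Q carrier_quotient_space V_simps by auto
    then show "x \<in> ?U"
      using bd_X bd_T by auto
  next
    fix x assume "x \<in> ?U"
    then obtain u where u: "x = chains_of K A Y 0 +>\<^bsub>V 0\<^esub> u" "u \<in> chains_of K A X 0" "u {r} \<in> T"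
      by auto
    then obtain c where c: "c \<in> chains_of K A X 1" "?bd c {r} = u {r}"
      using T_bd by blast
    then have "x = ?D 1 (chains_of K A Y 1 +>\<^bsub>V 1\<^esub> c)"
      using coset_cong[OF bd_X[OF c(1)] u(2)] u(1) D1[OF c(1)] by simp
    then show "x \<in> ?D 1 ` carrier (?Q 1)"
      using c(1) unfolding Q carrier_quotient_space V_simps by blast
  qed
  have "moebius_homology R \<omega> N \<phi> 0 r = homology ?Q ?D 0"
    by (simp add: moebius_homology_def relative_homology_def K_def A_def e_def X_def Y_def)
  also have "\<dots> = quotient_space ((?Q 0)\<lparr>carrier := carrier (?Q 0)\<rparr>) (?D 1 ` carrier (?Q 1))"
    using D0 by (simp add: homology_def cong: conj_cong)
  also have "\<dots> = quotient_space (quotient_space (V 0) (chains_of K A Y 0)) ?U"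
    unfolding img by (simp add: Q)
  finally show ?thesis
    using vdim_iterated_quotient[OF ev onto kernel T refl] by (simp add: T_def I_def)
qed

section \<open>The birth-death functor\<close>

lemma vectorspace_real_line: "vectorspace class_ring real_line"
  by (rule vectorspaceI) (simp_all add: real_line_def algebra_simps)

lemma linear_map_simp_boundary:
  "linear_map class_ring (simp_chain_space K s) (simp_chain_space K (s - 1)) (simp_boundary K \<omega> s)"
  unfolding simp_chain_space_def simp_boundary_def
  by (intro linear_map_boundary linear_mapI vectorspace_real_line) simp_all

lemma subspace_simp_chains:
  "VectorSpace.subspace class_ring (chains_of K (\<lambda>_. real_line) L s) (simp_chain_space K s)"
  unfolding simp_chain_space_def by (intro subspace_chains_of vectorspace_real_line)

lemma subspace_cycles:
  "VectorSpace.subspace class_ring (cycles K \<omega> \<rho> L) (simp_chain_space K \<rho>)"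
proof -
  interpret linear_map class_ring "simp_chain_space K \<rho>" "simp_chain_space K (\<rho> - 1)" "simp_boundary K \<omega> \<rho>"
    by (rule linear_map_simp_boundary)
  have "cycles K \<omega> \<rho> L = chains_of K (\<lambda>_. real_line) L \<rho> \<inter> ker"
    unfolding cycles_def ker_def by (auto simp: chains_of_def simp_chain_space_def)
  then show ?thesis
    using subspace_Int[OF subspace_simp_chains kerT_is_subspace] by simp
qed

lemma subspace_boundaries:
  "VectorSpace.subspace class_ring (boundaries K \<omega> \<rho> L) (simp_chain_space K \<rho>)"
  using subspace_image[OF linear_map_simp_boundary[of K "\<rho> + 1"] subspace_simp_chains]
  by (simp add: boundaries_def)

lemma cycles_mono: "L \<subseteq> L' \<Longrightarrow> cycles K \<omega> \<rho> L \<subseteq> cycles K \<omega> \<rho> L'"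
  unfolding cycles_def using chains_of_mono by blast

lemma boundaries_mono: "L \<subseteq> L' \<Longrightarrow> boundaries K \<omega> \<rho> L \<subseteq> boundaries K \<omega> \<rho> L'"
  unfolding boundaries_def by (intro image_mono chains_of_mono)

text \<open>Outside \<open>Seg P\<close> this can fail: the value of \<open>ZB_set\<close> at a pair with second entry
  \<open>Minf\<close> is unspecified.\<close>

lemma subspace_ZB_set:
  assumes "s \<in> Seg P"
  shows "VectorSpace.subspace class_ring (ZB_set K \<omega> F \<rho> s) (simp_chain_space K \<rho>)"
  using assms subspace_cycles subspace_Int[OF subspace_cycles subspace_boundaries]
  by (auto simp: Seg_def ZB_set_def)

lemma ZB_set_mono:
  assumes F: "mono_on P F" and s: "s \<in> Seg P" and t: "t \<in> Seg P" and "s \<le> t"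
  shows "ZB_set K \<omega> F \<rho> s \<subseteq> ZB_set K \<omega> F \<rho> t"
proof -
  have le: "F a \<subseteq> F b" if "a \<in> P" "b \<in> P" "a \<le> b" for a b
    using F that by (auto simp: mono_on_def)
  obtain b d b' d' where st: "s = (b, d)" "t = (b', d')" "b \<in> P" "b' \<in> P" "b \<le> b'" "d \<le> d'"
    using s t \<open>s \<le> t\<close> by (auto simp: Seg_def)
  have Z: "cycles K \<omega> \<rho> (F b) \<subseteq> cycles K \<omega> \<rho> (F b')"
    using st by (intro cycles_mono le)
  show ?thesis
  proof (cases d')
    case (Fin y)
    then obtain x where x: "d = Fin x" "x \<in> P" "y \<in> P" "x \<le> y"
      using s t st by (auto simp: Seg_def)
    then have "boundaries K \<omega> \<rho> (F x) \<subseteq> boundaries K \<omega> \<rho> (F y)"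
      by (intro boundaries_mono le)
    then show ?thesis
      using Z x Fin st by (auto simp: ZB_set_def)
  next
    case Pinf
    then show ?thesis
      using Z s st by (auto simp: ZB_set_def Seg_def)
  next
    case Minf
    then show ?thesis
      using t st by (auto simp: Seg_def)
  qed
qed

lemma finite_Seg: "finite P \<Longrightarrow> finite (Seg P)"
  by (rule finite_subset[of _ "P \<times> insert Pinf (Fin ` P)"]) (auto simp: Seg_def)

theorem corollary5p2:
  fixes P :: "'p::order set" and K :: "'v set set" and F :: "'p \<Rightarrow> 'v set set" and \<rho> :: int
    and \<omega>\<^sub>K :: "'v set \<Rightarrow> 'v list"
    and \<omega>\<^sub>\<Delta> :: "('p \<times> 'p extended) set \<Rightarrow> ('p \<times> 'p extended) list"
  assumes "finite P"
    and "simplicial_complex K" and "finite K"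
    and "filtration P K F"
    and "\<rho> \<ge> 0"
    and "orientation K \<omega>\<^sub>K"
    and "orientation (order_complex (Seg P)) \<omega>\<^sub>\<Delta>"
    and "(b, d) \<in> Seg P"
  shows "vdim (moebius_homology (Seg P) \<omega>\<^sub>\<Delta> (ZB K \<omega>\<^sub>K F \<rho>) ZB_map 0 (b, d))
    = born_dying P K \<omega>\<^sub>K F \<rho> (b, d)"
proof -
  let ?N = "ZB K \<omega>\<^sub>K F \<rho>" and ?Z = "ZB_set K \<omega>\<^sub>K F \<rho>" and ?C = "simp_chain_space K \<rho>"
  let ?I = "{t \<in> Seg P. t < (b, d)}"
  have mono: "mono_on P F"
    using assms(4) by (simp add: filtration_def)
  have Z: "VectorSpace.subspace class_ring (?Z t) ?C" if "t \<in> Seg P" for t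
    using that by (rule subspace_ZB_set)
  have N: "vectorspace class_ring (?N t)" if "t \<in> Seg P" for t
    unfolding ZB_def using Z[OF that]
    by (auto intro: vectorspace.subspace_is_vs simp: VectorSpace.subspace_def)
  have inclusion: "linear_map class_ring (?N s) (?N t) (ZB_map s t)"
    if "s \<in> Seg P" "t \<in> Seg P" "s \<le> t" for s t
    by (rule linear_mapI[OF N N])
      (use that ZB_set_mono[OF mono that] in \<open>auto simp: ZB_def ZB_map_def\<close>)
  \<comment> \<open>As the maps are inclusions, their images are the birth-death spaces of smaller
      segments.\<close>
  have "subspace_family_sum (?N (b, d)) ?I (\<lambda>t. ZB_map t (b, d) ` carrier (?N t))
      = subspace_family_sum (?N (b, d)) ?I ?Z"
    by (simp add: ZB_map_def ZB_def)
  also have "\<dots> = W P K \<omega>\<^sub>K F \<rho> (b, d)"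
  proof -
    have "finsum (?N (b, d)) x ?I = finsum ?C x ?I" if x: "\<forall>t\<in>?I. x t \<in> ?Z t" for x
      unfolding ZB_def
    proof (rule finsum_subspace[OF Z[OF assms(8)]])
      show "x \<in> ?I \<rightarrow> ?Z (b, d)"
      proof
        fix t assume t: "t \<in> ?I"
        then have "?Z t \<subseteq> ?Z (b, d)"
          using assms(8) by (intro ZB_set_mono[OF mono]) auto
        then show "x t \<in> ?Z (b, d)"
          using x t by blast
      qed
    qed
    then show ?thesis
      unfolding W_def subspace_family_sum_def
      by (intro Collect_cong ex_cong1 rev_conj_cong[OF refl]) (simp only:)
  qed
  finally have W: "subspace_family_sum (?N (b, d)) ?I (\<lambda>t. ZB_map t (b, d) ` carrier (?N t))
      = W P K \<omega>\<^sub>K F \<rho> (b, d)" .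
  have "vdim (moebius_homology (Seg P) \<omega>\<^sub>\<Delta> ?N ZB_map 0 (b, d))
      = vdim (quotient_space (?N (b, d)) (W P K \<omega>\<^sub>K F \<rho> (b, d)))"
    unfolding W[symmetric]
    by (rule vdim_moebius_homology_0[OF finite_Seg[OF assms(1)] assms(8) N inclusion])
  then show ?thesis
    by (simp add: born_dying_def)
qed

end
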